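(* Let $k$ be a field, $<$ a monomial preorder on $k[X]=k[x_1,\dots,x_n]$, and $I$ a homogeneous ideal in $k[X]$. Then $$\operatorname{depth}(k[X]/I)\ge\operatorname{depth}(k[X]/L_<(I)),$$ $$\operatorname{reg}(k[X]/I)\le\operatorname{reg}(k[X]/L_<(I)).$$
   Context: "Homogeneous" is with respect to the standard grading $\deg x_i=1$. For $a\in\mathbb{N}^n$ write $x^a=x_1^{\alpha_1}\cdots x_n^{\alpha_n}$. A weak order on a set is a strict partial order for which incomparability is an equivalence relation. A monomial preorder on $k[X]$ is a weak order $<$ on the monomials such that for all $a,b,c\in\mathbb{N}^n$: $x^a<x^b$ if and only if $x^ax^c<x^bx^c$. For $f=\sum c_ax^a\in k[X]$, the leading part $L_<(f)$ is the sum of those terms $c_ax^a$ ($c_a\ne0$) such that no monomial $x^b$ occurring in $f$ satisfies $x^a<x^b$. For $I\subseteq k[X]$, $L_<(I)$ is the ideal of $k[X]$ generated by all $L_<(f)$, $f\in I$; for homogeneous $I$ it is again homogeneous. For a finitely generated graded $k[X]$-module $E$, let $\beta_{i,j}(E)=\dim_k\operatorname{Tor}_i^{k[X]}(E,k)_j$ be its graded Betti numbers; then the depth and the Castelnuovo–Mumford regularity are $\operatorname{depth}E=n-\max\{i\mid\beta_{i,j}(E)\neq0\text{ for some }j\}$ and $\operatorname{reg}E=\max\{j-i\mid\beta_{i,j}(E)\neq0\}$. *)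

theory Defs
  imports
    Complex_Main
    "HOL-Library.Poly_Mapping"
    "HOL-Library.Function_Algebras"
    "HOL-Library.Cardinality"
    "HOL-Library.Extended_Real"
begin

section \<open>Polynomials and homogeneous ideals\<close>

text \<open>
  The variables are indexed by a finite type \<open>'n\<close>, so that \<open>n = CARD('n)\<close>; the exponent vectors in
  \<open>\<nat>\<^sup>n\<close> are the elements of \<open>'n \<Rightarrow>\<^sub>0 nat\<close>, and the monomial \<open>x\<^sup>a\<close> is identified with \<open>a\<close>. The
  multiplication of the type below is the convolution product, i.e. that of polynomials.
\<close>

type_synonym 'n monom = "'n \<Rightarrow>\<^sub>0 nat"
type_synonym ('n, 'k) mpoly = "('n \<Rightarrow>\<^sub>0 nat) \<Rightarrow>\<^sub>0 'k"

text \<open>A ring as a module over itself: \<open>ideal.subspace\<close> are the ideals, \<open>ideal.span A\<close> is the ideal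
  generated by \<open>A\<close>.\<close>

global_interpretation ideal: module "(*) :: 'a::comm_ring_1 \<Rightarrow> 'a \<Rightarrow> 'a"
  by unfold_locales (simp_all add: algebra_simps)

definition mdeg :: "'n::finite monom \<Rightarrow> nat" where
  "mdeg a = (\<Sum>v\<in>UNIV. Poly_Mapping.lookup a v)"

text \<open>Degrees are integers because the twists \<open>S(-d)\<close> below are; the zero polynomial is homogeneous
  of every degree and the only one of negative degree.\<close>

definition homogeneous :: "int \<Rightarrow> ('n::finite, 'k::zero) mpoly \<Rightarrow> bool" where
  "homogeneous d f \<longleftrightarrow> (\<forall>a\<in>Poly_Mapping.keys f. int (mdeg a) = d)"

definition homogeneous_ideal :: "('n::finite, 'k::field) mpoly set \<Rightarrow> bool" where
  "homogeneous_ideal I \<longleftrightarrow> (\<exists>H. (\<forall>h\<in>H. \<exists>d. homogeneous d h) \<and> I = ideal.span H)"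

definition irrelevant_ideal :: "('n::finite, 'k::field) mpoly set" where
  "irrelevant_ideal = ideal.span (range (\<lambda>v. Poly_Mapping.single (Poly_Mapping.single v 1) 1))"


section \<open>Monomial preorders and leading ideals\<close>

definition weak_order :: "('a \<Rightarrow> 'a \<Rightarrow> bool) \<Rightarrow> bool" where
  "weak_order lt \<longleftrightarrow> irreflp lt \<and> transp lt \<and> equivp (\<lambda>a b. \<not> lt a b \<and> \<not> lt b a)"

definition monomial_preorder :: "('n monom \<Rightarrow> 'n monom \<Rightarrow> bool) \<Rightarrow> bool" where
  "monomial_preorder lt \<longleftrightarrow> weak_order lt \<and> (\<forall>a b c. lt a b \<longleftrightarrow> lt (a + c) (b + c))"

definition leading_part ::
    "('n monom \<Rightarrow> 'n monom \<Rightarrow> bool) \<Rightarrow> ('n, 'k::field) mpoly \<Rightarrow> ('n, 'k) mpoly" where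
  "leading_part lt f = (\<Sum>a | a \<in> Poly_Mapping.keys f \<and> \<not> (\<exists>b\<in>Poly_Mapping.keys f. lt a b).
       Poly_Mapping.single a (Poly_Mapping.lookup f a))"

definition leading_ideal ::
    "('n monom \<Rightarrow> 'n monom \<Rightarrow> bool) \<Rightarrow> ('n, 'k::field) mpoly set \<Rightarrow> ('n, 'k) mpoly set" where
  "leading_ideal lt I = ideal.span (leading_part lt ` I)"


section \<open>Graded free resolutions\<close>

text \<open>
  Let \<open>S\<close> be the polynomial ring. The data of a complex of finitely generated graded free modules
  \<open>\<dots> \<rightarrow> F\<^sub>2 \<rightarrow> F\<^sub>1 \<rightarrow> F\<^sub>0\<close>, together with an augmentation \<open>F\<^sub>0 \<rightarrow> S/J\<close>: the module
  \<open>F\<^sub>i = S(-d\<^sub>0) \<oplus> \<dots> \<oplus> S(-d\<^bsub>r-1\<^esub>)\<close> has rank \<open>r = rk F i\<close>, and its basis element \<open>e\<^sub>b\<close> has degree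
  \<open>d\<^sub>b = gdeg F i b\<close>. The map \<open>F\<^sub>i\<^sub>+\<^sub>1 \<rightarrow> F\<^sub>i\<close> has the matrix \<open>entry F i\<close> (row \<open>c\<close>, column \<open>b\<close>), and
  the augmentation sends \<open>e\<^sub>b\<close> to the class of \<open>aug F b\<close>. An element of \<open>F\<^sub>i\<close> is its vector of
  coordinates, extended by zero beyond \<open>rk F i\<close>.
\<close>

record 'p free_complex =
  rk :: "nat \<Rightarrow> nat"
  gdeg :: "nat \<Rightarrow> nat \<Rightarrow> int"
  entry :: "nat \<Rightarrow> nat \<Rightarrow> nat \<Rightarrow> 'p"
  aug :: "nat \<Rightarrow> 'p"

definition chains :: "('n, 'k::field) mpoly free_complex \<Rightarrow> nat \<Rightarrow> (nat \<Rightarrow> ('n, 'k) mpoly) set" where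
  "chains F i = {z. \<forall>b\<ge>rk F i. z b = 0}"

definition graded_chains ::
    "('n::finite, 'k::field) mpoly free_complex \<Rightarrow> nat \<Rightarrow> int \<Rightarrow> (nat \<Rightarrow> ('n, 'k) mpoly) set" where
  "graded_chains F i j = {z \<in> chains F i. \<forall>b<rk F i. homogeneous (j - gdeg F i b) (z b)}"

definition bdmap ::
    "('n, 'k::field) mpoly free_complex \<Rightarrow> nat \<Rightarrow> (nat \<Rightarrow> ('n, 'k) mpoly) \<Rightarrow> nat \<Rightarrow> ('n, 'k) mpoly" where
  "bdmap F i z = (\<lambda>c. if c < rk F i then \<Sum>b<rk F (Suc i). entry F i c b * z b else 0)"

definition augment ::
    "('n, 'k::field) mpoly free_complex \<Rightarrow> (nat \<Rightarrow> ('n, 'k) mpoly) \<Rightarrow> ('n, 'k) mpoly" where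
  "augment F z = (\<Sum>b<rk F 0. aug F b * z b)"

text \<open>\<open>F\<close> is a graded free resolution of \<open>S/J\<close>: all maps are homogeneous of degree 0, and
  \<open>\<dots> \<rightarrow> F\<^sub>1 \<rightarrow> F\<^sub>0 \<rightarrow> S/J \<rightarrow> 0\<close> is exact.\<close>

definition graded_free_resolution ::
    "('n::finite, 'k::field) mpoly set \<Rightarrow> ('n, 'k) mpoly free_complex \<Rightarrow> bool" where
  "graded_free_resolution J F \<longleftrightarrow>
     (\<forall>b<rk F 0. homogeneous (gdeg F 0 b) (aug F b)) \<and>
     (\<forall>i. \<forall>c<rk F i. \<forall>b<rk F (Suc i).
        homogeneous (gdeg F (Suc i) b - gdeg F i c) (entry F i c b)) \<and>
     (\<forall>f. \<exists>z\<in>chains F 0. f - augment F z \<in> J) \<and>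
     {z \<in> chains F 0. augment F z \<in> J} = bdmap F 0 ` chains F 1 \<and>
     (\<forall>i. {z \<in> chains F (Suc i). bdmap F i z = 0} = bdmap F (Suc i) ` chains F (Suc (Suc i)))"


section \<open>Tor and graded Betti numbers\<close>

text \<open>The vector space structure over \<open>k\<close> on vectors of polynomials.\<close>

definition vscale ::
    "'k::field \<Rightarrow> (nat \<Rightarrow> ('n, 'k) mpoly) \<Rightarrow> nat \<Rightarrow> ('n, 'k) mpoly" where
  "vscale c z = (\<lambda>b. Poly_Mapping.single 0 c * z b)"

global_interpretation poly_vec:
  vector_space "vscale :: 'k::field \<Rightarrow> (nat \<Rightarrow> ('n, 'k) mpoly) \<Rightarrow> _"
proof
  fix a b :: 'k and x y :: "nat \<Rightarrow> ('n, 'k) mpoly"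
  show "vscale a (x + y) = vscale a x + vscale a y"
    by (simp add: vscale_def fun_eq_iff distrib_left)
  show "vscale (a + b) x = vscale a x + vscale b x"
    by (simp add: vscale_def fun_eq_iff distrib_right single_add)
  show "vscale a (vscale b x) = vscale (a * b) x"
    by (simp add: vscale_def fun_eq_iff mult_single flip: mult.assoc)
  show "vscale 1 x = x"
    by (simp add: vscale_def fun_eq_iff)
qed

text \<open>
  The module \<open>S/I \<otimes> F\<^sub>i\<close> is \<open>F\<^sub>i / I F\<^sub>i\<close>, where \<open>I F\<^sub>i\<close> consists of the vectors with entries
  in \<open>I\<close>. The two sets below are the preimages in the degree \<open>j\<close> part of \<open>F\<^sub>i\<close> of the cycles and of
  the boundaries of \<open>S/I \<otimes> F\<close>. Both contain the degree \<open>j\<close> part of \<open>I F\<^sub>i\<close>, so the quotient of the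
  first by the second is the degree \<open>j\<close> part of the \<open>i\<close>-th homology of \<open>S/I \<otimes> F\<close>.
\<close>

definition tensor_cycles ::
    "('n::finite, 'k::field) mpoly set \<Rightarrow> ('n, 'k) mpoly free_complex \<Rightarrow> nat \<Rightarrow> int
      \<Rightarrow> (nat \<Rightarrow> ('n, 'k) mpoly) set" where
  "tensor_cycles I F i j =
     {z \<in> graded_chains F i j. i = 0 \<or> (\<forall>c. bdmap F (i - 1) z c \<in> I)}"

definition tensor_boundaries ::
    "('n::finite, 'k::field) mpoly set \<Rightarrow> ('n, 'k) mpoly free_complex \<Rightarrow> nat \<Rightarrow> int
      \<Rightarrow> (nat \<Rightarrow> ('n, 'k) mpoly) set" where
  "tensor_boundaries I F i j =
     {z \<in> graded_chains F i j. \<exists>w\<in>graded_chains F (Suc i) j. \<forall>c. z c - bdmap F i w c \<in> I}"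

text \<open>
  \<open>dim\<^sub>k Tor\<^sub>i(S/I, S/J)\<^sub>j\<close> for homogeneous ideals \<open>I\<close> and \<open>J\<close>, where \<open>Tor\<^sub>i(S/I, _)\<close> is the \<open>i\<close>-th left
  derived functor of \<open>S/I \<otimes> _\<close>: it is computed with any graded free resolution of \<open>S/J\<close> by finitely
  generated modules. One exists since \<open>S\<close> is Noetherian, and the result does not depend on it. The
  spaces of cycles and boundaries are finite-dimensional, so the dimension of the quotient is the
  difference of the dimensions.
\<close>

definition tor_dim ::
    "('n::finite, 'k::field) mpoly set \<Rightarrow> ('n, 'k) mpoly set \<Rightarrow> nat \<Rightarrow> int \<Rightarrow> nat" where
  "tor_dim I J i j =
     (let F = (SOME F. graded_free_resolution J F)
      in poly_vec.dim (tensor_cycles I F i j) - poly_vec.dim (tensor_boundaries I F i j))"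

text \<open>The graded Betti numbers, the depth and the regularity of \<open>E = S/I\<close>; here \<open>k = S/(x\<^sub>1,\<dots>,x\<^sub>n)\<close>.\<close>

definition betti :: "('n::finite, 'k::field) mpoly set \<Rightarrow> nat \<Rightarrow> int \<Rightarrow> nat" where
  "betti I i j = tor_dim I irrelevant_ideal i j"

text \<open>If \<open>S/I\<close> is nonzero, only finitely many Betti numbers are nonzero and the suprema are maxima.
  For \<open>S/I = 0\<close> they are suprema of the empty set, which gives the usual conventions \<open>depth 0 = \<infinity>\<close>
  and \<open>reg 0 = -\<infinity>\<close>.\<close>

definition depth_quot :: "('n::finite, 'k::field) mpoly set \<Rightarrow> ereal" where
  "depth_quot I = ereal (real CARD('n)) - Sup {ereal (real i) | i. \<exists>j. betti I i j \<noteq> 0}"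

definition reg_quot :: "('n::finite, 'k::field) mpoly set \<Rightarrow> ereal" where
  "reg_quot I = Sup {ereal (real_of_int (j - int i)) | i j. betti I i j \<noteq> 0}"

end

theory Submission
  imports Defs
begin

text \<open>
  It suffices that \<open>Tor\<^sub>i(S/I, k)\<^sub>j\<close> vanishes whenever \<open>Tor\<^sub>i(S/L(I), k)\<^sub>j\<close> does. Vanishing does not
  depend on the resolution of \<open>k\<close>, so take a multigraded resolution \<open>K\<close>: its differential preserves
  multidegrees, hence commutes with taking the part of a chain in one equivalence class of the
  preorder. If \<open>z\<close> is a cycle modulo \<open>I\<close>, its top part is a cycle modulo \<open>L(I)\<close>, hence a boundary up
  to an element of \<open>L(I) K\<close>; lifting the latter to \<open>I K\<close> and subtracting gives a cycle modulo \<open>I\<close> with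
  a smaller top part, and there are only finitely many multidegrees in degree \<open>j\<close>.
\<close>

text \<open>Resolving k instead of S/I lets one complex serve both ideals: only the ideal modulo
  which chains are read changes, and no resolution of S/L(I) has to be lifted. Two obstacles shape
  the argument. An element of L(I) is a sum of multiples of leading parts from several classes and
  degrees and in general is not itself a leading part of an element of I; hence lifts are made for
  one class and one degree at a time. And the preorder need not be well-founded (x < 1 is allowed),
  so the induction has to stay in a fixed degree, which is where the homogeneity of I is used. Since
  \<open>tor_dim\<close> picks its resolution arbitrarily, resolutions have to be compared, but only
  in order to transfer vanishing.\<close>

abbreviation (input) "lookup \<equiv> Poly_Mapping.lookup"
abbreviation (input) "keys \<equiv> Poly_Mapping.keys"
abbreviation (input) "single \<equiv> Poly_Mapping.single"

text \<open>As a simplification rule this is reverse associativity of multiplication, and loops with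
  \<open>mult.assoc\<close>.\<close>
declare ideal.scale_scale [simp del]

section \<open>Restricting polynomials to sets of monomials\<close>

definition restr :: "('a \<Rightarrow> bool) \<Rightarrow> ('a \<Rightarrow>\<^sub>0 'b::zero) \<Rightarrow> 'a \<Rightarrow>\<^sub>0 'b" where
  "restr P f = Abs_poly_mapping (\<lambda>a. if P a then lookup f a else 0)"

lemma lookup_restr: "lookup (restr P f) a = (if P a then lookup f a else 0)"
proof -
  have "finite {a. (if P a then lookup f a else 0) \<noteq> 0}"
    by (rule finite_subset[OF _ finite_lookup[of f]]) auto
  then show ?thesis by (simp add: restr_def)
qed

lemma keys_restr: "keys (restr P f) = {a \<in> keys f. P a}"
  by (auto simp: in_keys_iff lookup_restr split: if_splits)

lemma restr_0 [simp]: "restr P 0 = 0"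
  by (rule poly_mapping_eqI) (simp add: lookup_restr)

lemma restr_add: "restr P (f + g) = restr P f + restr P (g :: _ \<Rightarrow>\<^sub>0 'b::monoid_add)"
  by (rule poly_mapping_eqI) (simp add: lookup_restr lookup_add)

lemma restr_diff: "restr P (f - g) = restr P f - restr P (g :: _ \<Rightarrow>\<^sub>0 'b::ab_group_add)"
  by (rule poly_mapping_eqI) (simp add: lookup_restr lookup_minus)

lemma restr_sum: "restr P (sum f A) = (\<Sum>x\<in>A. restr P (f x :: _ \<Rightarrow>\<^sub>0 'b::comm_monoid_add))"
  by (induction A rule: infinite_finite_induct) (simp_all add: restr_add)

lemma restr_cong: "f = g \<Longrightarrow> (\<And>a. a \<in> keys g \<Longrightarrow> P a = Q a) \<Longrightarrow> restr P f = restr Q g"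
  by (rule poly_mapping_eqI) (auto simp: lookup_restr in_keys_iff)

lemma restr_id: "(\<And>a. a \<in> keys f \<Longrightarrow> P a) \<Longrightarrow> restr P f = f"
  by (rule poly_mapping_eqI) (auto simp: lookup_restr in_keys_iff)

lemma restr_zeroI: "(\<And>a. a \<in> keys f \<Longrightarrow> \<not> P a) \<Longrightarrow> restr P f = 0"
  by (rule poly_mapping_eqI) (auto simp: lookup_restr in_keys_iff)

lemma restr_single: "restr P (single a c) = (if P a then single a c else 0)"
  by (rule poly_mapping_eqI) (auto simp: lookup_restr lookup_single when_def)

lemma sum_singles: "(\<Sum>a\<in>keys f. single a (lookup f a)) = (f :: _ \<Rightarrow>\<^sub>0 'b::comm_monoid_add)"
  by (rule poly_mapping_eqI) (auto simp: lookup_sum lookup_single when_def in_keys_iff)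

text \<open>The hypothesis lets \<open>P\<close> be tested on the second factor alone, so terms of
  the expanded product are selected before any cancellation. It holds for \<open>f\<close>
  homogeneous and \<open>P\<close> a condition on the degree, for matrix entries of a single
  multidegree, and for \<open>f\<close> a single term; these are the three uses.\<close>

lemma restr_mult:
  fixes f g :: "'a::monoid_add \<Rightarrow>\<^sub>0 'b::semiring_0"
  assumes "\<And>a b. a \<in> keys f \<Longrightarrow> P (a + b) = Q b"
  shows "restr P (f * g) = f * restr Q g"
proof -
  have fg: "f * h = (\<Sum>a\<in>keys f. \<Sum>b\<in>keys h. single (a + b) (lookup f a * lookup h b))" for h
    by (subst (1) sum_singles[of f, symmetric], subst (1) sum_singles[of h, symmetric])
       (simp only: sum_distrib_right, simp only: sum_distrib_left mult_single)
  have "restr P (f * g) = (\<Sum>a\<in>keys f. \<Sum>b\<in>keys g. if Q b then single (a + b) (lookup f a * lookup g b) else 0)"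
    unfolding fg restr_sum by (rule sum.cong[OF refl], rule sum.cong[OF refl]) (simp add: restr_single assms)
  also have "\<dots> = (\<Sum>a\<in>keys f. \<Sum>b\<in>keys (restr Q g). single (a + b) (lookup f a * lookup (restr Q g) b))"
    by (intro sum.cong refl sum.mono_neutral_cong_right) (auto simp: keys_restr lookup_restr)
  finally show ?thesis by (simp add: fg)
qed


section \<open>Homogeneous polynomials\<close>

lemma mdeg_add: "mdeg (a + b) = mdeg a + mdeg b"
  by (simp add: mdeg_def lookup_add sum.distrib)

lemma homogeneous_0 [simp]: "homogeneous d 0"
  by (simp add: homogeneous_def)

lemma homogeneous_1: "homogeneous 0 1"
  by (simp add: homogeneous_def mdeg_def)

lemma homogeneous_single: "int (mdeg a) = d \<Longrightarrow> homogeneous d (single a c)"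
  by (auto simp: homogeneous_def split: if_splits)

lemma homogeneous_add:
  "homogeneous d f \<Longrightarrow> homogeneous d g \<Longrightarrow> homogeneous d (f + g :: ('n::finite, 'k::field) mpoly)"
  using keys_add[of f g] by (auto simp: homogeneous_def)

lemma homogeneous_diff:
  "homogeneous d f \<Longrightarrow> homogeneous d g \<Longrightarrow> homogeneous d (f - g :: ('n::finite, 'k::field) mpoly)"
  by (auto simp: homogeneous_def in_keys_iff lookup_minus)

lemma homogeneous_sum:
  "(\<And>x. x \<in> A \<Longrightarrow> homogeneous d (f x)) \<Longrightarrow> homogeneous d (\<Sum>x\<in>A. f x :: ('n::finite, 'k::field) mpoly)"
  by (induction A rule: infinite_finite_induct) (auto intro: homogeneous_add)

lemma homogeneous_mult:
  assumes "homogeneous d f" "homogeneous e g" "c = d + e"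
  shows "homogeneous c (f * g :: ('n::finite, 'k::field) mpoly)"
  using assms keys_mult[of f g] by (fastforce simp: homogeneous_def mdeg_add)

lemma homogeneous_restr: "homogeneous d f \<Longrightarrow> homogeneous d (restr P f)"
  by (simp add: homogeneous_def keys_restr)

definition hcomp :: "int \<Rightarrow> ('n::finite, 'k::field) mpoly \<Rightarrow> ('n, 'k) mpoly" where
  "hcomp d f = restr (\<lambda>a. int (mdeg a) = d) f"

lemma homogeneous_hcomp: "homogeneous d (hcomp d f)"
  by (simp add: hcomp_def homogeneous_def keys_restr)

lemma hcomp_homogeneous: "homogeneous d f \<Longrightarrow> hcomp d f = f"
  by (auto simp: hcomp_def homogeneous_def intro: restr_id)

lemma hcomp_mult: "homogeneous d f \<Longrightarrow> hcomp e (f * g) = f * hcomp (e - d) g"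
  unfolding hcomp_def by (rule restr_mult) (auto simp: homogeneous_def mdeg_add)

lemma hcomp_sum: "hcomp d (sum f A) = (\<Sum>x\<in>A. hcomp d (f x))"
  by (simp add: hcomp_def restr_sum)

lemma hcomp_in_homogeneous_ideal:
  assumes "homogeneous_ideal I" "f \<in> I"
  shows "hcomp d f \<in> I"
proof -
  from assms obtain H where H: "\<And>h. h \<in> H \<Longrightarrow> \<exists>d. homogeneous d h" and I: "I = ideal.span H"
    by (auto simp: homogeneous_ideal_def)
  from assms(2) show ?thesis unfolding I
  proof (induction rule: ideal.span_induct_alt)
    case base
    then show ?case by (simp add: hcomp_def ideal.span_zero)
  next
    case (step c x y)
    obtain e where "homogeneous e x" using H[OF step(1)] ..
    then have "hcomp d (c * x + y) = hcomp (d - e) c * x + hcomp d y"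
      using hcomp_mult[of e x d c] by (simp add: hcomp_def restr_add mult.commute[of c] mult.commute[of "restr _ _" x])
    then show ?case using step
      by (simp add: ideal.span_add ideal.span_scale ideal.span_base)
  qed
qed


section \<open>Graded linear maps between free modules\<close>

definition linmap :: "((nat \<Rightarrow> 'a::comm_ring_1) \<Rightarrow> nat \<Rightarrow> 'a) \<Rightarrow> bool" where
  "linmap \<phi> \<longleftrightarrow> (\<forall>x y. \<phi> (x + y) = \<phi> x + \<phi> y) \<and> (\<forall>f x. \<phi> (\<lambda>b. f * x b) = (\<lambda>c. f * \<phi> x c))"

definition unit_vec :: "nat \<Rightarrow> nat \<Rightarrow> 'a::zero_neq_one" where
  "unit_vec b = (\<lambda>c. if c = b then 1 else 0)"

lemma linmap_add: "linmap \<phi> \<Longrightarrow> \<phi> (x + y) = \<phi> x + \<phi> y"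
  by (simp add: linmap_def)

lemma linmap_scale: "linmap \<phi> \<Longrightarrow> \<phi> (\<lambda>b. f * x b) = (\<lambda>c. f * \<phi> x c)"
  by (simp add: linmap_def)

lemma linmap_0: "linmap \<phi> \<Longrightarrow> \<phi> 0 = 0"
  using linmap_add[of \<phi> 0 0] by simp

lemma linmap_diff: "linmap \<phi> \<Longrightarrow> \<phi> (x - y) = \<phi> x - \<phi> y"
  using linmap_add[of \<phi> "x - y" y] by simp

lemma linmap_sum:
  assumes "linmap \<phi>"
  shows "\<phi> (sum f A) = (\<Sum>x\<in>A. \<phi> (f x))"
proof (induction A rule: infinite_finite_induct)
  case (insert x A)
  have "\<phi> (sum f (insert x A)) = \<phi> (f x) + \<phi> (sum f A)"
    using insert.hyps by (simp only: sum.insert linmap_add[OF assms] not_False_eq_True)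
  then show ?case using insert by (simp only: sum.insert not_False_eq_True)
qed (simp_all only: sum.infinite sum.empty linmap_0[OF assms] not_False_eq_True)

lemma linmap_comp: "linmap \<phi> \<Longrightarrow> linmap \<psi> \<Longrightarrow> linmap (\<lambda>z. \<phi> (\<psi> z))"
  by (simp add: linmap_def)

lemma linmap_minus: "linmap \<phi> \<Longrightarrow> linmap \<psi> \<Longrightarrow> linmap (\<lambda>z. \<phi> z - \<psi> z)"
  by (simp add: linmap_def fun_eq_iff right_diff_distrib)

lemma linmap_ident: "linmap (\<lambda>z. z)"
  by (simp add: linmap_def)

lemma linmap_matrix: "linmap (\<lambda>z c. \<Sum>b<r. z b * Y b c)"
  unfolding linmap_def
proof (intro conjI allI ext)
  fix x y c
  show "(\<Sum>b<r. (x + y) b * Y b c) = ((\<lambda>c. \<Sum>b<r. x b * Y b c) + (\<lambda>c. \<Sum>b<r. y b * Y b c)) c"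
    by (simp add: distrib_right sum.distrib)
next
  fix f x c
  show "(\<Sum>b<r. f * x b * Y b c) = f * (\<Sum>b<r. x b * Y b c)"
    by (simp add: sum_distrib_left mult.assoc)
qed

lemma bdmap_eq:
  "bdmap F i = (\<lambda>z c. \<Sum>b<rk F (Suc i). z b * (if c < rk F i then entry F i c b else 0))"
  by (intro ext) (simp add: bdmap_def mult.commute)

lemma linmap_bdmap: "linmap (bdmap F i)"
  unfolding bdmap_eq by (rule linmap_matrix)

lemma sum_fun_apply: "(sum f A) x = (\<Sum>a\<in>A. f a x)"
  by (induction A rule: infinite_finite_induct) auto

lemma chain_expansion:
  assumes "z \<in> chains F i"
  shows "z = (\<Sum>b<rk F i. (\<lambda>c. z b * unit_vec b c))"
proof
  fix c
  have "(\<Sum>b<rk F i. z b * unit_vec b c) = (\<Sum>b<rk F i. if b = c then z c else 0)"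
    by (intro sum.cong) (auto simp: unit_vec_def)
  also have "\<dots> = z c" using assms by (simp add: chains_def)
  finally show "z c = (\<Sum>b<rk F i. (\<lambda>c. z b * unit_vec b c)) c"
    by (simp add: sum_fun_apply)
qed

lemma linmap_expansion:
  assumes "linmap \<phi>" "z \<in> chains F i"
  shows "\<phi> z c = (\<Sum>b<rk F i. z b * \<phi> (unit_vec b) c)"
proof -
  have "\<phi> z = (\<Sum>b<rk F i. (\<lambda>c. z b * \<phi> (unit_vec b) c))"
    by (subst chain_expansion[OF assms(2)]) (simp add: linmap_sum linmap_scale assms(1))
  then show ?thesis by (simp add: sum_fun_apply)
qed

lemma linmap_eqI:
  assumes "linmap \<phi>" "linmap \<psi>" "z \<in> chains F i" "\<And>b. b < rk F i \<Longrightarrow> \<phi> (unit_vec b) = \<psi> (unit_vec b)"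
  shows "\<phi> z = \<psi> z"
  using assms by (auto simp: fun_eq_iff linmap_expansion[OF _ assms(3)])

lemma linmap_ideal:
  assumes "linmap \<phi>" "z \<in> chains F i" "ideal.subspace I" "\<And>b. z b \<in> I"
  shows "\<phi> z c \<in> I"
  unfolding linmap_expansion[OF assms(1,2)]
  by (intro ideal.subspace_sum assms(3)) (metis assms(3,4) ideal.subspace_scale mult.commute)

lemma unit_vec_chain: "b < rk F i \<Longrightarrow> unit_vec b \<in> chains F i"
  by (auto simp: chains_def unit_vec_def)

lemma unit_vec_graded: "b < rk F i \<Longrightarrow> unit_vec b \<in> graded_chains F i (gdeg F i b)"
  by (auto simp: graded_chains_def unit_vec_chain) (auto simp: unit_vec_def homogeneous_1)

lemma graded_chains_chains: "z \<in> graded_chains F i j \<Longrightarrow> z \<in> chains F i"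
  by (simp add: graded_chains_def)

lemma chains_diff: "z \<in> chains F i \<Longrightarrow> w \<in> chains F i \<Longrightarrow> z - w \<in> chains F i"
  and chains_0: "0 \<in> chains F i"
  by (simp_all add: chains_def)

lemma graded_chains_add: "z \<in> graded_chains F i j \<Longrightarrow> w \<in> graded_chains F i j \<Longrightarrow> z + w \<in> graded_chains F i j"
  and graded_chains_diff: "z \<in> graded_chains F i j \<Longrightarrow> w \<in> graded_chains F i j \<Longrightarrow> z - w \<in> graded_chains F i j"
  and graded_chains_0: "0 \<in> graded_chains F i j"
  by (simp_all add: graded_chains_def chains_def homogeneous_add homogeneous_diff)

definition graded_map where
  "graded_map F i G l \<phi> \<longleftrightarrow> linmap \<phi> \<and> (\<forall>z\<in>chains F i. \<phi> z \<in> chains G l) \<and>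
     (\<forall>j. \<forall>z\<in>graded_chains F i j. \<phi> z \<in> graded_chains G l j)"

lemma graded_map_comp:
  "graded_map G l H m \<psi> \<Longrightarrow> graded_map F i G l \<phi> \<Longrightarrow> graded_map F i H m (\<lambda>z. \<psi> (\<phi> z))"
  by (simp add: graded_map_def linmap_comp)

lemma graded_map_minus:
  "graded_map F i G l \<phi> \<Longrightarrow> graded_map F i G l \<psi> \<Longrightarrow> graded_map F i G l (\<lambda>z. \<phi> z - \<psi> z)"
  by (simp add: graded_map_def linmap_minus chains_diff graded_chains_diff)

lemma graded_map_ident: "graded_map F i F i (\<lambda>z. z)"
  by (simp add: graded_map_def linmap_ident)

lemma graded_map_linmap: "graded_map F i G l \<phi> \<Longrightarrow> linmap \<phi>"
  by (simp add: graded_map_def)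

lemma graded_map_matrix:
  assumes "\<And>b. b < rk F i \<Longrightarrow> Y b \<in> graded_chains G l (gdeg F i b)"
  shows "graded_map F i G l (\<lambda>z c. \<Sum>b<rk F i. z b * Y b c)"
  unfolding graded_map_def
proof (intro conjI ballI allI linmap_matrix)
  fix z assume "z \<in> chains F i"
  then show *: "(\<lambda>c. \<Sum>b<rk F i. z b * Y b c) \<in> chains G l"
    using assms by (auto simp: chains_def graded_chains_def)
next
  fix z j assume z: "z \<in> graded_chains F i j"
  have "homogeneous (j - gdeg G l c) (\<Sum>b<rk F i. z b * Y b c)" if "c < rk G l" for c
  proof (intro homogeneous_sum)
    fix b assume "b \<in> {..<rk F i}"
    with z assms[of b] that show "homogeneous (j - gdeg G l c) (z b * Y b c)"
      by (intro homogeneous_mult[of "j - gdeg F i b" _ "gdeg F i b - gdeg G l c"])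
         (auto simp: graded_chains_def)
  qed
  then show "(\<lambda>c. \<Sum>b<rk F i. z b * Y b c) \<in> graded_chains G l j"
    using assms by (auto simp: chains_def graded_chains_def)
qed

lemma matrix_unit_vec:
  fixes Y :: "nat \<Rightarrow> nat \<Rightarrow> 'a::comm_ring_1"
  shows "b < r \<Longrightarrow> (\<lambda>c. \<Sum>b'<r. unit_vec b b' * Y b' c) = Y b"
proof
  fix c assume "b < r"
  have "(\<Sum>b'<r. unit_vec b b' * Y b' c) = (\<Sum>b'<r. if b' = b then Y b c else 0)"
    by (intro sum.cong) (auto simp: unit_vec_def)
  then show "(\<Sum>b'<r. unit_vec b b' * Y b' c) = Y b c" using \<open>b < r\<close> by simp
qed

text \<open>Uniform treatment of the two exactness conditions, at \<open>F\<^sub>0\<close> (modulo \<open>J\<close>) and at \<open>F\<^sub>i\<close>.\<close>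

definition cycle where
  "cycle J F i z \<longleftrightarrow> z \<in> chains F i \<and>
     (case i of 0 \<Rightarrow> augment F z \<in> J | Suc l \<Rightarrow> bdmap F l z = 0)"

lemma resolution_exact:
  assumes "graded_free_resolution J F"
  shows "cycle J F i z \<longleftrightarrow> z \<in> bdmap F i ` chains F (Suc i)"
proof -
  have "{z \<in> chains F 0. augment F z \<in> J} = bdmap F 0 ` chains F 1"
    "{z \<in> chains F (Suc l). bdmap F l z = 0} = bdmap F (Suc l) ` chains F (Suc (Suc l))" for l
    using assms by (auto simp: graded_free_resolution_def)
  then show ?thesis by (cases i) (simp_all add: cycle_def set_eq_iff)
qed

lemma resolution_augment:
  "graded_free_resolution J F \<Longrightarrow> \<exists>z\<in>chains F 0. f - augment F z \<in> J"
  by (simp add: graded_free_resolution_def)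

lemma resolution_bdmap_graded:
  assumes "graded_free_resolution J F"
  shows "graded_map F (Suc i) F i (bdmap F i)"
proof -
  show ?thesis
    unfolding bdmap_eq using assms
    by (intro graded_map_matrix) (auto simp: graded_chains_def chains_def graded_free_resolution_def)
qed

lemma resolution_bdmap_bdmap:
  assumes "graded_free_resolution J F" "z \<in> chains F (Suc (Suc i))"
  shows "bdmap F i (bdmap F (Suc i) z) = 0"
  using assms(2) resolution_exact[OF assms(1), of "Suc i" "bdmap F (Suc i) z"]
  by (auto simp: cycle_def)

text \<open>Exactness of a resolution is stated without degrees, while
  \<open>tensor_boundaries\<close> asks for a homogeneous preimage. Keeping only the right degree in
  each coordinate of a preimage works because the matrix entries are homogeneous.\<close>

lemma resolution_exact_graded:
  assumes res: "graded_free_resolution J F" and "cycle J F i z" and z: "z \<in> graded_chains F i j"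
  shows "\<exists>w\<in>graded_chains F (Suc i) j. bdmap F i w = z"
proof -
  obtain w where w: "w \<in> chains F (Suc i)" "bdmap F i w = z"
    using resolution_exact[OF res, of i z] assms(2) by auto
  define w' where "w' = (\<lambda>b. hcomp (j - gdeg F (Suc i) b) (w b))"
  have "w' \<in> graded_chains F (Suc i) j"
    using w(1) by (auto simp: w'_def graded_chains_def chains_def homogeneous_hcomp)
      (simp add: hcomp_def)
  moreover have "bdmap F i w' c = z c" for c
  proof (cases "c < rk F i")
    case True
    have "z c = hcomp (j - gdeg F i c) (z c)"
      using z True by (simp add: graded_chains_def hcomp_homogeneous)
    also have "\<dots> = (\<Sum>b<rk F (Suc i). hcomp (j - gdeg F i c) (entry F i c b * w b))"
      using True by (simp flip: w(2) add: bdmap_def hcomp_sum)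
    also have "\<dots> = (\<Sum>b<rk F (Suc i). entry F i c b * w' b)"
    proof (intro sum.cong refl)
      fix b assume "b \<in> {..<rk F (Suc i)}"
      then have "homogeneous (gdeg F (Suc i) b - gdeg F i c) (entry F i c b)"
        using res True by (simp add: graded_free_resolution_def)
      then show "hcomp (j - gdeg F i c) (entry F i c b * w b) = entry F i c b * w' b"
        by (simp add: hcomp_mult w'_def)
    qed
    finally show ?thesis using True by (simp add: bdmap_def)
  next
    case False
    then show ?thesis using z by (simp add: bdmap_def graded_chains_def chains_def)
  qed
  ultimately show ?thesis by (auto simp: fun_eq_iff)
qed

text \<open>Free modules are projective: homogeneous preimages of the values on the basis are the
  columns of \<open>h\<close>. Both the comparison maps and the homotopies are built from
  this.\<close>

lemma graded_lift:
  assumes res: "graded_free_resolution J G" and T: "graded_map F i G l T"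
    and cyc: "\<And>z. z \<in> chains F i \<Longrightarrow> cycle J G l (T z)"
  shows "\<exists>h. graded_map F i G (Suc l) h \<and> (\<forall>z\<in>chains F i. bdmap G l (h z) = T z)"
proof -
  have "\<exists>y. y \<in> graded_chains G (Suc l) (gdeg F i b) \<and> bdmap G l y = T (unit_vec b)"
    if "b < rk F i" for b
    using resolution_exact_graded[OF res cyc] T that
    by (meson graded_map_def unit_vec_chain unit_vec_graded)
  then obtain Y where Y: "\<And>b. b < rk F i \<Longrightarrow> Y b \<in> graded_chains G (Suc l) (gdeg F i b)"
    "\<And>b. b < rk F i \<Longrightarrow> bdmap G l (Y b) = T (unit_vec b)"
    by metis
  let ?h = "\<lambda>z c. \<Sum>b<rk F i. z b * Y b c"
  have h: "graded_map F i G (Suc l) ?h" by (rule graded_map_matrix) (rule Y)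
  have "bdmap G l (?h z) = T z" if "z \<in> chains F i" for z
    by (rule linmap_eqI[OF linmap_comp[OF linmap_bdmap graded_map_linmap[OF h]]
          graded_map_linmap[OF T] that])
       (simp add: matrix_unit_vec Y(2))
  with h show ?thesis by blast
qed


section \<open>Comparison of resolutions\<close>

lemma augment_add: "augment F (x + y) = augment F x + augment F y"
  and augment_diff: "augment F (x - y) = augment F x - augment F y"
  by (simp_all add: augment_def algebra_simps sum.distrib sum_subtractf)

lemma augment_scale: "augment F (\<lambda>b. f * x b) = f * augment F x"
  by (simp add: augment_def sum_distrib_left algebra_simps)

lemma augment_sum: "augment F (sum f A) = (\<Sum>x\<in>A. augment F (f x))"
proof (induction A rule: infinite_finite_induct)
  case (insert x A)
  then show ?case by (simp only: sum.insert augment_add not_False_eq_True)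
qed (simp_all add: augment_def)

definition chain_map where
  "chain_map J F G f \<longleftrightarrow> (\<forall>i. graded_map F i G i (f i)) \<and>
     (\<forall>z\<in>chains F 0. augment G (f 0 z) - augment F z \<in> J) \<and>
     (\<forall>i. \<forall>z\<in>chains F (Suc i). bdmap G i (f (Suc i) z) = f i (bdmap F i z))"

lemma comparison_chain_map:
  assumes F: "graded_free_resolution J F" and G: "graded_free_resolution J G"
    and J: "homogeneous_ideal J" "ideal.subspace J"
  shows "\<exists>f. chain_map J F G f"
proof -
  let ?A = "\<lambda>g. \<forall>z\<in>chains F 0. augment G (g z) - augment F z \<in> J"
  \<comment> \<open>The invariant already says that \<open>g\<close> sends boundaries of
    \<open>F\<close> to cycles of \<open>G\<close>. This is what the next lift requires, so that
    dependent choice can build the whole sequence.\<close>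
  let ?P = "\<lambda>i g. graded_map F i G i g \<and> (\<forall>z\<in>chains F (Suc i). cycle J G i (g (bdmap F i z))) \<and>
    (i = 0 \<longrightarrow> ?A g)"
  let ?Q = "\<lambda>i g g'. \<forall>z\<in>chains F (Suc i). bdmap G i (g' z) = g (bdmap F i z)"
  have bdF: "bdmap F i z \<in> chains F i" if "z \<in> chains F (Suc i)" for i z
    using resolution_bdmap_graded[OF F] that by (simp add: graded_map_def)
  have "\<exists>y. y \<in> graded_chains G 0 (gdeg F 0 b) \<and> augment G y - aug F b \<in> J" if b: "b < rk F 0" for b
  proof -
    obtain y where y: "y \<in> chains G 0" "aug F b - augment G y \<in> J"
      using resolution_augment[OF G] by blast
    define y' where "y' = (\<lambda>c. hcomp (gdeg F 0 b - gdeg G 0 c) (y c))"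
    have "y' \<in> graded_chains G 0 (gdeg F 0 b)"
      using y(1) by (auto simp: y'_def graded_chains_def chains_def homogeneous_hcomp)
        (simp add: hcomp_def)
    moreover have "hcomp (gdeg F 0 b) (augment G y) = augment G y'"
      using G unfolding augment_def hcomp_sum y'_def
      by (intro sum.cong refl hcomp_mult) (simp add: graded_free_resolution_def)
    moreover have "hcomp (gdeg F 0 b) (aug F b) = aug F b"
      using F b by (simp add: graded_free_resolution_def hcomp_homogeneous)
    ultimately have "aug F b - augment G y' \<in> J"
      using hcomp_in_homogeneous_ideal[OF J(1) y(2), of "gdeg F 0 b"] by (simp add: hcomp_def restr_diff)
    then have "augment G y' - aug F b \<in> J"
      using ideal.subspace_neg[OF J(2)] by fastforce
    with \<open>y' \<in> _\<close> show ?thesis by blast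
  qed
  then obtain Y where Y: "\<And>b. b < rk F 0 \<Longrightarrow> Y b \<in> graded_chains G 0 (gdeg F 0 b)"
    "\<And>b. b < rk F 0 \<Longrightarrow> augment G (Y b) - aug F b \<in> J"
    by metis
  have "\<exists>f. \<forall>i. ?P i (f i) \<and> ?Q i (f i) (f (Suc i))"
  proof (rule dependent_nat_choice)
    let ?g = "\<lambda>z c. \<Sum>b<rk F 0. z b * Y b c"
    have g: "graded_map F 0 G 0 ?g" by (rule graded_map_matrix) (rule Y)
    have A: "?A ?g"
    proof
      fix z assume "z \<in> chains F 0"
      have "?g z = (\<Sum>b<rk F 0. (\<lambda>c. z b * Y b c))" by (simp add: fun_eq_iff sum_fun_apply)
      then have "augment G (?g z) - augment F z = (\<Sum>b<rk F 0. z b * (augment G (Y b) - aug F b))"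
        by (simp add: augment_sum augment_scale right_diff_distrib sum_subtractf)
           (simp add: augment_def mult.commute)
      also have "\<dots> \<in> J" by (intro ideal.subspace_sum ideal.subspace_scale J Y(2)) auto
      finally show "augment G (?g z) - augment F z \<in> J" .
    qed
    have "cycle J G 0 (?g (bdmap F 0 z))" if z: "z \<in> chains F (Suc 0)" for z
    proof -
      have "augment F (bdmap F 0 z) \<in> J"
        using resolution_exact[OF F, of 0 "bdmap F 0 z"] z by (auto simp: cycle_def)
      with A bdF[OF z] have "augment G (?g (bdmap F 0 z)) \<in> J"
        using ideal.subspace_add[OF J(2)] by fastforce
      then show ?thesis using g bdF[OF z] by (simp add: cycle_def graded_map_def)
    qed
    with g A show "\<exists>g. ?P 0 g" by blast
  next
    fix g i assume P: "?P i g"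
    have "graded_map F (Suc i) G i (\<lambda>z. g (bdmap F i z))"
      using P resolution_bdmap_graded[OF F] graded_map_comp by blast
    from graded_lift[OF G this] P obtain g' where
      g': "graded_map F (Suc i) G (Suc i) g'" "?Q i g g'" by blast
    have "cycle J G (Suc i) (g' (bdmap F (Suc i) z))" if "z \<in> chains F (Suc (Suc i))" for z
      using g' P bdF[OF that] resolution_bdmap_bdmap[OF F that]
      by (auto simp: cycle_def graded_map_def linmap_0)
    with g' show "\<exists>g'. ?P (Suc i) g' \<and> ?Q i g g'" by blast
  qed
  then show ?thesis by (auto simp: chain_map_def)
qed

text \<open>The map \<open>f - id\<close> covers zero on S/J and is therefore null-homotopic: at
  each stage \<open>f - id - h d\<close> takes values in cycles and is lifted. Degree 0 is separate
  because cycles there are defined by the augmentation modulo \<open>J\<close>.\<close>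

lemma comparison_homotopy:
  assumes F: "graded_free_resolution J F" and J: "ideal.subspace J" and f: "chain_map J F F f"
  shows "\<exists>h. \<forall>i. graded_map F i F (Suc i) (h i) \<and>
    (\<forall>z\<in>chains F (Suc i). bdmap F (Suc i) (h (Suc i) z) = f (Suc i) z - z - h i (bdmap F i z)) \<and>
    (\<forall>z\<in>chains F 0. bdmap F 0 (h 0 z) = f 0 z - z)"
proof -
  let ?A = "\<lambda>g. \<forall>z\<in>chains F 0. bdmap F 0 (g z) = f 0 z - z"
  let ?P = "\<lambda>i g. graded_map F i F (Suc i) g \<and>
    (\<forall>z\<in>chains F (Suc i). cycle J F (Suc i) (f (Suc i) z - z - g (bdmap F i z))) \<and>
    (i = 0 \<longrightarrow> ?A g)"
  let ?Q = "\<lambda>i g g'. \<forall>z\<in>chains F (Suc i). bdmap F (Suc i) (g' z) = f (Suc i) z - z - g (bdmap F i z)"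
  note bd = resolution_bdmap_graded[OF F]
  have bdF: "bdmap F i z \<in> chains F i" if "z \<in> chains F (Suc i)" for i z
    using bd that by (simp add: graded_map_def)
  have fg: "graded_map F i F i (f i)" for i using f by (simp add: chain_map_def)
  have psi: "graded_map F i F i (\<lambda>z. f i z - z)" for i
    by (intro graded_map_minus fg graded_map_ident)
  have psi_c: "f i z - z \<in> chains F i" if "z \<in> chains F i" for i z
    using psi that by (simp add: graded_map_def)
  have bdpsi: "bdmap F i (f (Suc i) z - z) = f i (bdmap F i z) - bdmap F i z"
    if "z \<in> chains F (Suc i)" for i z
    using f that by (simp add: chain_map_def linmap_diff[OF linmap_bdmap])
  have "\<exists>h. \<forall>i. ?P i (h i) \<and> ?Q i (h i) (h (Suc i))"
  proof (rule dependent_nat_choice)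
    have "cycle J F 0 (f 0 z - z)" if "z \<in> chains F 0" for z
      using f that psi_c[OF that] by (simp add: chain_map_def cycle_def augment_diff)
    from graded_lift[OF F psi this] obtain g where g: "graded_map F 0 F (Suc 0) g" "?A g" by blast
    have "cycle J F (Suc 0) (f (Suc 0) z - z - g (bdmap F 0 z))" if "z \<in> chains F (Suc 0)" for z
      using g bdF[OF that] bdpsi[OF that] psi_c[OF that]
      by (simp add: cycle_def chains_diff graded_map_def linmap_diff[OF linmap_bdmap])
    with g show "\<exists>g. ?P 0 g" by blast
  next
    fix g i assume P: "?P i g"
    have "graded_map F (Suc i) F (Suc i) (\<lambda>z. f (Suc i) z - z - g (bdmap F i z))"
      using P bd psi graded_map_comp graded_map_minus by blast
    from graded_lift[OF F this] P obtain g' where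
      g': "graded_map F (Suc i) F (Suc (Suc i)) g'" "?Q i g g'" by blast
    have g0: "g 0 = 0" using P linmap_0[OF graded_map_linmap] by blast
    have "cycle J F (Suc (Suc i)) (f (Suc (Suc i)) z - z - g' (bdmap F (Suc i) z))"
      if "z \<in> chains F (Suc (Suc i))" for z
      using g' P g0 bdF[OF that] bdpsi[OF that] psi_c[OF that] resolution_bdmap_bdmap[OF F that]
      by (simp add: cycle_def chains_diff graded_map_def linmap_diff[OF linmap_bdmap])
    with g' show "\<exists>g'. ?P (Suc i) g' \<and> ?Q i g g'" by blast
  qed
  then show ?thesis by auto
qed

lemma chain_map_comp:
  assumes "ideal.subspace J" "chain_map J F G f" "chain_map J G H g"
  shows "chain_map J F H (\<lambda>i z. g i (f i z))"
proof -
  have "augment H (g 0 (f 0 z)) - augment F z \<in> J" if "z \<in> chains F 0" for z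
  proof -
    have "f 0 z \<in> chains G 0" using assms(2) that by (simp add: chain_map_def graded_map_def)
    then have "(augment H (g 0 (f 0 z)) - augment G (f 0 z)) + (augment G (f 0 z) - augment F z) \<in> J"
      using assms that by (intro ideal.subspace_add) (auto simp: chain_map_def)
    then show ?thesis by simp
  qed
  with assms(2,3) show ?thesis
    unfolding chain_map_def by (auto intro: graded_map_comp) (metis graded_map_def)
qed

text \<open>For vanishing, a single homotopy from \<open>g f\<close> to the identity of
  \<open>F\<close> suffices: a cycle of \<open>F\<close> is moved to \<open>G\<close>, bounded
  there, and the bounding chain is moved back and corrected by the homotopy.\<close>

lemma tensor_exact_transfer:
  assumes F: "graded_free_resolution J F" and G: "graded_free_resolution J G"
    and J: "homogeneous_ideal J" "ideal.subspace J" and I: "ideal.subspace I"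
    and ex: "tensor_cycles I G i j \<subseteq> tensor_boundaries I G i j"
  shows "tensor_cycles I F i j \<subseteq> tensor_boundaries I F i j"
proof
  fix z assume "z \<in> tensor_cycles I F i j"
  then have z: "z \<in> graded_chains F i j" and dz: "i = 0 \<or> (\<forall>c. bdmap F (i - 1) z c \<in> I)"
    by (auto simp: tensor_cycles_def)
  obtain f where f: "chain_map J F G f" using comparison_chain_map[OF F G J] ..
  obtain g where g: "chain_map J G F g" using comparison_chain_map[OF G F J] ..
  obtain h where h: "\<And>i. graded_map F i F (Suc i) (h i)"
    "\<And>i z. z \<in> chains F (Suc i) \<Longrightarrow>
      bdmap F (Suc i) (h (Suc i) z) = g (Suc i) (f (Suc i) z) - z - h i (bdmap F i z)"
    "\<And>z. z \<in> chains F 0 \<Longrightarrow> bdmap F 0 (h 0 z) = g 0 (f 0 z) - z"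
    using comparison_homotopy[OF F J(2) chain_map_comp[OF J(2) f g]] by blast
  have fm: "graded_map F l G l (f l)" and gm: "graded_map G l F l (g l)" for l
    using f g by (auto simp: chain_map_def)
  have zc: "z \<in> chains F i" using z by (rule graded_chains_chains)
  have fz: "f i z \<in> graded_chains G i j" using fm z by (simp add: graded_map_def)
  moreover have "bdmap G (i - 1) (f i z) c \<in> I" if "i \<noteq> 0" for c
    using that
  proof (cases i)
    case l: (Suc l)
    have "bdmap F l z \<in> chains F l"
      using resolution_bdmap_graded[OF F] zc by (simp add: graded_map_def l)
    then have "f l (bdmap F l z) c \<in> I"
      by (rule linmap_ideal[OF graded_map_linmap[OF fm] _ I]) (use dz in \<open>auto simp: l\<close>)
    then show ?thesis using f zc by (simp add: chain_map_def l)
  qed simp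
  ultimately have "f i z \<in> tensor_cycles I G i j" by (auto simp: tensor_cycles_def)
  with ex obtain w where w: "w \<in> graded_chains G (Suc i) j" "\<And>c. (f i z - bdmap G i w) c \<in> I"
    by (auto simp: tensor_boundaries_def)
  have wc: "w \<in> chains G (Suc i)" using w(1) by (rule graded_chains_chains)
  have bw: "bdmap G i w \<in> chains G i"
    using resolution_bdmap_graded[OF G] wc by (simp add: graded_map_def)
  \<comment> \<open>Modulo \<open>I\<close> one has \<open>d (g w) = g (d w) = g (f z)\<close> and
    \<open>d (h z) = g (f z) - z\<close>, the term \<open>h (d z)\<close> having its coordinates in
    \<open>I\<close>. Hence \<open>d w' = z\<close> modulo \<open>I\<close>.\<close>
  define w' where "w' = g (Suc i) w - h i z"
  have "w' \<in> graded_chains F (Suc i) j"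
    using gm h(1) w(1) z by (auto simp: w'_def graded_map_def intro!: graded_chains_diff)
  moreover have "(z - bdmap F i w') c \<in> I" for c
  proof -
    have 1: "g i (f i z - bdmap G i w) c \<in> I"
      using chains_diff[OF graded_chains_chains[OF fz] bw]
      by (rule linmap_ideal[OF graded_map_linmap[OF gm] _ I w(2)])
    have 2: "(g i (f i z) - z - bdmap F i (h i z)) c \<in> I"
    proof (cases i)
      case 0
      then show ?thesis using h(3) zc I by (simp add: ideal.subspace_0)
    next
      case (Suc l)
      have "bdmap F l z \<in> chains F l"
        using resolution_bdmap_graded[OF F] zc by (simp add: graded_map_def Suc)
      then have "h l (bdmap F l z) c \<in> I"
        by (rule linmap_ideal[OF graded_map_linmap[OF h(1)] _ I]) (use dz in \<open>auto simp: Suc\<close>)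
      then show ?thesis using h(2)[of z l] zc by (simp add: Suc)
    qed
    have "bdmap F i (g (Suc i) w) = g i (bdmap G i w)" using g wc by (simp add: chain_map_def)
    then have "(z - bdmap F i w') c = g i (f i z - bdmap G i w) c - (g i (f i z) - z - bdmap F i (h i z)) c"
      by (simp add: w'_def linmap_diff[OF linmap_bdmap] linmap_diff[OF graded_map_linmap[OF gm]])
    then show ?thesis using ideal.subspace_diff[OF I 1 2] by (simp only:)
  qed
  ultimately show "z \<in> tensor_boundaries I F i j"
    using z by (auto simp: tensor_boundaries_def)
qed


section \<open>Degeneration of multigraded complexes\<close>

text \<open>The basis element \<open>e\<^sub>b\<close> of the \<open>i\<close>-th module has multidegree \<open>\<mu> i b\<close>.\<close>

definition multigraded ::
    "('n::finite, 'k::field) mpoly free_complex \<Rightarrow> (nat \<Rightarrow> nat \<Rightarrow> 'n monom) \<Rightarrow> bool" where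
  "multigraded K \<mu> \<longleftrightarrow> (\<forall>i. \<forall>b<rk K i. gdeg K i b = int (mdeg (\<mu> i b))) \<and>
     (\<forall>i. \<forall>c<rk K i. \<forall>b<rk K (Suc i). \<forall>a\<in>keys (entry K i c b). a + \<mu> i c = \<mu> (Suc i) b)"

text \<open>A term \<open>x^a e_b\<close> has multidegree \<open>a + \<nu> b\<close>. Chains are cut
  according to these multidegrees, which are comparable across coordinates, unlike the bare
  monomials of the single coordinates.\<close>

definition vrestr where
  "vrestr \<nu> P z = (\<lambda>b. restr (\<lambda>a. P (a + \<nu> b)) (z b))"

definition msupp where
  "msupp \<nu> z = {a + \<nu> b | a b. a \<in> keys (z b)}"

lemma msuppI: "a \<in> keys (z b) \<Longrightarrow> a + \<nu> b \<in> msupp \<nu> z"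
  by (auto simp: msupp_def)

lemma vrestr_bdmap:
  assumes "multigraded K \<mu>"
  shows "vrestr (\<mu> i) P (bdmap K i z) = bdmap K i (vrestr (\<mu> (Suc i)) P z)"
proof
  fix c
  show "vrestr (\<mu> i) P (bdmap K i z) c = bdmap K i (vrestr (\<mu> (Suc i)) P z) c"
  proof (cases "c < rk K i")
    case True
    have "restr (\<lambda>a. P (a + \<mu> i c)) (entry K i c b * z b) =
        entry K i c b * restr (\<lambda>a. P (a + \<mu> (Suc i) b)) (z b)" if b: "b < rk K (Suc i)" for b
    proof (rule restr_mult)
      fix a a' assume "a \<in> keys (entry K i c b)"
      then have "a + \<mu> i c = \<mu> (Suc i) b" using assms True b by (simp add: multigraded_def)
      then show "P (a + a' + \<mu> i c) = P (a' + \<mu> (Suc i) b)"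
        by (metis add.assoc add.commute)
    qed
    with True show ?thesis by (simp add: vrestr_def bdmap_def restr_sum)
  qed (simp add: vrestr_def bdmap_def)
qed

lemma vrestr_graded: "z \<in> graded_chains F i j \<Longrightarrow> vrestr \<nu> P z \<in> graded_chains F i j"
  by (simp add: graded_chains_def chains_def vrestr_def homogeneous_restr)

lemma msupp_bdmap:
  assumes "multigraded K \<mu>"
  shows "msupp (\<mu> i) (bdmap K i z) \<subseteq> msupp (\<mu> (Suc i)) z"
proof -
  \<comment> \<open>Selecting the support of \<open>z\<close> leaves \<open>z\<close> unchanged. As
    the selection commutes with the differential, the image is unchanged too and has no other
    multidegrees.\<close>
  let ?P = "\<lambda>m. m \<in> msupp (\<mu> (Suc i)) z"
  have "vrestr (\<mu> (Suc i)) ?P z = z"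
    by (auto simp: vrestr_def fun_eq_iff intro!: restr_id msuppI)
  then have "bdmap K i z = vrestr (\<mu> i) ?P (bdmap K i z)"
    by (simp add: vrestr_bdmap[OF assms])
  then have "bdmap K i z c = restr (\<lambda>a. ?P (a + \<mu> i c)) (bdmap K i z c)" for c
    by (simp add: vrestr_def fun_eq_iff)
  then have "keys (bdmap K i z c) \<subseteq> {a. ?P (a + \<mu> i c)}" for c
    by (metis (no_types, lifting) keys_restr mem_Collect_eq subsetI)
  then show ?thesis by (auto simp: msupp_def[of "\<mu> i"])
qed

lemma msupp_degree:
  assumes "multigraded K \<mu>" "z \<in> graded_chains K i j" "m \<in> msupp (\<mu> i) z"
  shows "int (mdeg m) = j"
proof -
  obtain a b where m: "m = a + \<mu> i b" "a \<in> keys (z b)" using assms(3) by (auto simp: msupp_def)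
  then have "b < rk K i" using assms(2) by (auto simp: graded_chains_def chains_def not_less[symmetric])
  with assms m show ?thesis
    by (auto simp: mdeg_add graded_chains_def homogeneous_def multigraded_def)
qed

lemma finite_mdeg: "finite {m :: 'n::finite monom. int (mdeg m) = j}"
proof (rule finite_imageD)
  have "lookup m v \<le> nat j" if "int (mdeg m) = j" for m :: "'n monom" and v
  proof -
    have "lookup m v \<le> mdeg m"
      unfolding mdeg_def by (rule member_le_sum) auto
    then show ?thesis using that by linarith
  qed
  then have "lookup ` {m :: 'n monom. int (mdeg m) = j} \<subseteq>
      {f. \<forall>v. (v \<in> UNIV \<longrightarrow> f v \<in> {..nat j}) \<and> (v \<notin> UNIV \<longrightarrow> f v = 0)}"
    by blast
  then show "finite (lookup ` {m :: 'n monom. int (mdeg m) = j})"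
    by (rule finite_subset) (rule finite_set_of_finite_funs; simp)
  show "inj_on lookup {m :: 'n monom. int (mdeg m) = j}"
    by (simp add: inj_on_def poly_mapping.lookup_inject)
qed

section \<open>Monomial preorders and the top class of a polynomial\<close>

locale mono_preorder =
  fixes lt :: "'n::finite monom \<Rightarrow> 'n monom \<Rightarrow> bool"
  assumes monomial_preorder: "monomial_preorder lt"
begin

definition eqv where "eqv a b \<longleftrightarrow> \<not> lt a b \<and> \<not> lt b a"

lemma lt_irrefl: "\<not> lt a a"
  using monomial_preorder by (auto simp: monomial_preorder_def weak_order_def irreflp_def)

lemma lt_trans: "lt a b \<Longrightarrow> lt b c \<Longrightarrow> lt a c"
  using monomial_preorder by (auto simp: monomial_preorder_def weak_order_def transp_def)

lemma lt_add: "lt (a + c) (b + c) \<longleftrightarrow> lt a b"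
  using monomial_preorder by (auto simp: monomial_preorder_def)

text \<open>If \<open>a\<close> lay below \<open>c\<close>, then \<open>b\<close> would be
  incomparable with both, and transitivity of incomparability would make \<open>a\<close> and
  \<open>c\<close> incomparable.\<close>

lemma not_lt_trans:
  assumes "\<not> lt a b" "\<not> lt b c"
  shows "\<not> lt a c"
proof
  assume ac: "lt a c"
  have "transp eqv"
    using monomial_preorder
    by (auto simp: monomial_preorder_def weak_order_def equivp_reflp_symp_transp eqv_def[abs_def])
  moreover have "eqv a b" "eqv b c" using assms ac lt_trans by (auto simp: eqv_def)
  ultimately have "eqv a c" by (rule transpD)
  with ac show False by (simp add: eqv_def)
qed

lemma leading_part_eq_restr: "leading_part lt f = restr (\<lambda>a. \<forall>b\<in>keys f. \<not> lt a b) f"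
proof -
  let ?r = "restr (\<lambda>a. \<forall>b\<in>keys f. \<not> lt a b) f"
  have "leading_part lt f = (\<Sum>a\<in>keys ?r. single a (lookup ?r a))"
    unfolding leading_part_def by (rule sum.cong) (auto simp: keys_restr lookup_restr)
  then show ?thesis by (simp only: sum_singles)
qed

text \<open>Translation invariance makes maximality in \<open>keys f\<close> testable against a
  fixed \<open>M\<close> after adding \<open>\<nu>\<close>. In the main induction
  \<open>\<nu>\<close> is the multidegree of a basis element, so that all coordinates of a chain are
  measured against the same \<open>M\<close>.\<close>

lemma leading_part_eq_class:
  assumes "\<And>a. a \<in> keys f \<Longrightarrow> \<not> lt M (a + \<nu>)" and a0: "a0 \<in> keys f" "eqv (a0 + \<nu>) M"
  shows "leading_part lt f = restr (\<lambda>a. eqv (a + \<nu>) M) f"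
  unfolding leading_part_eq_restr
proof (rule restr_cong[OF refl])
  fix a assume a: "a \<in> keys f"
  show "(\<forall>b\<in>keys f. \<not> lt a b) = eqv (a + \<nu>) M"
  proof
    assume "\<forall>b\<in>keys f. \<not> lt a b"
    then have "\<not> lt (a + \<nu>) (a0 + \<nu>)" using a0 by (simp add: lt_add)
    then have "\<not> lt (a + \<nu>) M" using a0 not_lt_trans by (auto simp: eqv_def)
    then show "eqv (a + \<nu>) M" using assms(1)[OF a] by (simp add: eqv_def)
  next
    assume e: "eqv (a + \<nu>) M"
    show "\<forall>b\<in>keys f. \<not> lt a b"
    proof
      fix b assume "b \<in> keys f"
      then have "\<not> lt (a + \<nu>) (b + \<nu>)" using e assms(1) not_lt_trans by (auto simp: eqv_def)
      then show "\<not> lt a b" by (simp add: lt_add)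
    qed
  qed
qed

lemma top_class_in_leading_ideal:
  assumes "f \<in> I" "\<And>a. a \<in> keys f \<Longrightarrow> \<not> lt M (a + \<nu>)"
  shows "restr (\<lambda>a. eqv (a + \<nu>) M) f \<in> leading_ideal lt I"
proof (cases "\<exists>a\<in>keys f. eqv (a + \<nu>) M")
  case True
  then have "leading_part lt f = restr (\<lambda>a. eqv (a + \<nu>) M) f"
    using leading_part_eq_class assms(2) by blast
  then show ?thesis
    unfolding leading_ideal_def using assms(1) by (metis ideal.span_base image_eqI)
next
  case False
  then have "restr (\<lambda>a. eqv (a + \<nu>) M) f = 0" by (intro restr_zeroI) auto
  then show ?thesis by (simp add: leading_ideal_def ideal.span_zero)
qed

text \<open>The shift \<open>\<nu>\<close> makes this property of \<open>g\<close> stable under multiplication by monomials.\<close>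

definition liftable where
  "liftable I g \<longleftrightarrow> (\<forall>e \<nu> M. \<exists>f\<in>I. homogeneous e f \<and> (\<forall>a\<in>keys f. \<not> lt M (a + \<nu>)) \<and>
     restr (\<lambda>a. eqv (a + \<nu>) M) f = restr (\<lambda>a. eqv (a + \<nu>) M \<and> int (mdeg a) = e) g)"

lemma liftable_0: "ideal.subspace I \<Longrightarrow> liftable I 0"
  unfolding liftable_def by (auto intro!: bexI[of _ 0] ideal.subspace_0)

text \<open>Cancellation of top parts does no harm: the condition prescribes the part in the class
  of \<open>M\<close>, which may be 0, rather than the leading part of the lift.\<close>

lemma liftable_add:
  assumes "ideal.subspace I" "liftable I (g :: ('n, 'k::field) mpoly)" "liftable I h"
  shows "liftable I (g + h)"
  unfolding liftable_def
proof (intro allI)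
  fix e \<nu> M
  let ?P = "\<lambda>a. eqv (a + \<nu>) M"
  obtain f f' where "f \<in> I" "homogeneous e f" "\<forall>a\<in>keys f. \<not> lt M (a + \<nu>)"
      "restr ?P f = restr (\<lambda>a. ?P a \<and> int (mdeg a) = e) g"
    and "f' \<in> I" "homogeneous e f'" "\<forall>a\<in>keys f'. \<not> lt M (a + \<nu>)"
      "restr ?P f' = restr (\<lambda>a. ?P a \<and> int (mdeg a) = e) h"
    using assms(2,3) unfolding liftable_def by metis
  then show "\<exists>f\<in>I. homogeneous e f \<and> (\<forall>a\<in>keys f. \<not> lt M (a + \<nu>)) \<and>
     restr ?P f = restr (\<lambda>a. ?P a \<and> int (mdeg a) = e) (g + h)"
    using keys_add[of f f'] assms(1)
    by (intro bexI[of _ "f + f'"]) (auto simp: restr_add homogeneous_add ideal.subspace_add)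
qed

lemma liftable_single:
  assumes "ideal.subspace I" "liftable I (g :: ('n, 'k::field) mpoly)"
  shows "liftable I (single m r * g)"
  unfolding liftable_def
proof (intro allI)
  fix e \<nu> M
  let ?P = "\<lambda>a. eqv (a + \<nu>) M" and ?Q = "\<lambda>a. eqv (a + (\<nu> + m)) M"
  let ?e = "e - int (mdeg m)"
  \<comment> \<open>The factor is absorbed into shift and degree: a lift of \<open>g\<close> for
    \<open>\<nu> + m\<close> and \<open>?e\<close>, multiplied by the term, is a lift for
    \<open>\<nu>\<close> and \<open>e\<close>. A negative \<open>?e\<close> only forces
    \<open>f = 0\<close>.\<close>
  obtain f where f: "f \<in> I" "homogeneous ?e f" "\<forall>a\<in>keys f. \<not> lt M (a + (\<nu> + m))"
      "restr ?Q f = restr (\<lambda>a. ?Q a \<and> int (mdeg a) = ?e) g"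
    using assms(2) unfolding liftable_def by metis
  have shift: "m + a + \<nu> = a + (\<nu> + m)" for a by (simp add: add_ac)
  have keys: "keys (single m r * f) \<subseteq> {m + a | a. a \<in> keys f}"
    using keys_mult[of "single m r" f] by (auto split: if_splits)
  have "restr ?P (single m r * f) = single m r * restr ?Q f"
    by (rule restr_mult) (auto simp: shift split: if_splits)
  also have "\<dots> = restr (\<lambda>a. ?P a \<and> int (mdeg a) = e) (single m r * g)"
    unfolding f(4) by (rule restr_mult[symmetric]) (auto simp: shift mdeg_add split: if_splits)
  finally have "restr ?P (single m r * f) = restr (\<lambda>a. ?P a \<and> int (mdeg a) = e) (single m r * g)" .
  moreover have "homogeneous e (single m r * f)"
    by (rule homogeneous_mult[OF homogeneous_single f(2)]) auto
  moreover have "\<forall>a\<in>keys (single m r * f). \<not> lt M (a + \<nu>)"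
    using keys f(3) by (auto simp: shift)
  moreover have "single m r * f \<in> I" using f(1) assms(1) by (simp add: ideal.subspace_scale)
  ultimately show "\<exists>f\<in>I. homogeneous e f \<and> (\<forall>a\<in>keys f. \<not> lt M (a + \<nu>)) \<and>
     restr ?P f = restr (\<lambda>a. ?P a \<and> int (mdeg a) = e) (single m r * g)"
    by blast
qed

lemma liftable_mult:
  assumes "ideal.subspace I" "liftable I (g :: ('n, 'k::field) mpoly)"
  shows "liftable I (c * g)"
proof -
  have "liftable I (\<Sum>a\<in>A. single a (lookup c a) * g)" for A
    by (induction A rule: infinite_finite_induct)
       (use assms in \<open>auto intro: liftable_0 liftable_add liftable_single\<close>)
  from this[of "keys c"] show ?thesis by (simp only: sum_distrib_right[symmetric] sum_singles)
qed

text \<open>All monomials of the leading part lie in one class. If, after the shift, this is the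
  class of \<open>M\<close>, then the component of \<open>f\<close> in degree \<open>e\<close> is a
  lift, and it lies in \<open>I\<close> by homogeneity; otherwise 0 is a lift.\<close>

lemma liftable_leading_part:
  assumes I: "homogeneous_ideal I" "ideal.subspace I" and f: "(f :: ('n, 'k::field) mpoly) \<in> I"
  shows "liftable I (leading_part lt f)"
  unfolding liftable_def
proof (intro allI)
  fix e \<nu> M
  let ?P = "\<lambda>a. eqv (a + \<nu>) M" and ?L = "leading_part lt f"
  show "\<exists>g\<in>I. homogeneous e g \<and> (\<forall>a\<in>keys g. \<not> lt M (a + \<nu>)) \<and>
     restr ?P g = restr (\<lambda>a. ?P a \<and> int (mdeg a) = e) ?L"
  proof (cases "\<exists>a\<in>keys ?L. ?P a")
    case True
    then obtain a0 where a0: "a0 \<in> keys f" "?P a0" "\<forall>b\<in>keys f. \<not> lt a0 b"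
      by (auto simp: leading_part_eq_restr keys_restr)
    have le: "\<not> lt M (a + \<nu>)" if "a \<in> keys f" for a
    proof -
      have "\<not> lt (a0 + \<nu>) (a + \<nu>)" using a0 that by (simp add: lt_add)
      then show ?thesis using a0(2) not_lt_trans by (auto simp: eqv_def)
    qed
    have L: "?L = restr ?P f" by (rule leading_part_eq_class[OF le a0(1,2)])
    have "restr ?P (hcomp e f) = restr (\<lambda>a. ?P a \<and> int (mdeg a) = e) ?L"
      by (rule poly_mapping_eqI) (simp add: L hcomp_def lookup_restr)
    moreover have "\<forall>a\<in>keys (hcomp e f). \<not> lt M (a + \<nu>)"
      using le by (auto simp: hcomp_def keys_restr)
    ultimately show ?thesis
      using hcomp_in_homogeneous_ideal[OF I(1) f] homogeneous_hcomp by blast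
  next
    case False
    then have "restr (\<lambda>a. ?P a \<and> int (mdeg a) = e) ?L = 0" by (intro restr_zeroI) auto
    then show ?thesis using I by (intro bexI[of _ 0]) (auto simp: ideal.subspace_0)
  qed
qed

text \<open>The generators are liftable, and sums and multiples stay so. This replaces the claim,
  false in general, that each element of the leading ideal is the leading part of an element of
  \<open>I\<close>.\<close>

lemma leading_ideal_liftable:
  assumes "homogeneous_ideal I" "ideal.subspace I" "g \<in> leading_ideal lt I"
  shows "liftable I (g :: ('n, 'k::field) mpoly)"
  using assms(3) unfolding leading_ideal_def
proof (induction rule: ideal.span_induct_alt)
  case base
  show ?case using liftable_0 assms(2) .
next
  case (step c x y)
  then show ?case using assms(1,2) by (auto intro!: liftable_add liftable_mult liftable_leading_part)
qed

lemma tensor_exact_degeneration: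
  fixes I :: "('n, 'k::field) mpoly set"
  assumes K: "multigraded K \<mu>" and res: "graded_free_resolution J K"
    and I: "homogeneous_ideal I" "ideal.subspace I"
    and ex: "tensor_cycles (leading_ideal lt I) K i j \<subseteq> tensor_boundaries (leading_ideal lt I) K i j"
  shows "tensor_cycles I K i j \<subseteq> tensor_boundaries I K i j"
proof
  note bd = resolution_bdmap_graded[OF res]
  \<comment> \<open>The monomials of degree \<open>j\<close> that lie below, or are equivalent to,
    some multidegree of \<open>z\<close>. This set is finite and loses \<open>M\<close> once the top
    class of \<open>z\<close> is removed, so its size can carry the induction.\<close>
  define N where "N z = {m. int (mdeg m) = j \<and> (\<exists>m'\<in>msupp (\<mu> i) z. \<not> lt m' m)}" for z :: "nat \<Rightarrow> ('n, 'k) mpoly"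
  have finN: "finite (N z)" for z
    by (rule finite_subset[OF _ finite_mdeg[of j]]) (auto simp: N_def)
  fix z assume "z \<in> tensor_cycles I K i j"
  then show "z \<in> tensor_boundaries I K i j"
  proof (induction "card (N z)" arbitrary: z rule: less_induct)
    case less
    have z: "z \<in> graded_chains K i j" and dz: "\<And>l c. i = Suc l \<Longrightarrow> bdmap K l z c \<in> I"
      using less.prems by (auto simp: tensor_cycles_def)
    show ?case
    proof (cases "msupp (\<mu> i) z = {}")
      case True
      then have "keys (z b) = {}" for b using msuppI[of _ z b "\<mu> i"] by blast
      then have "z b = 0" for b by (intro poly_mapping_eqI) (metis in_keys_iff empty_iff lookup_zero)
      then have "z = 0" by (simp add: fun_eq_iff)
      then have "\<forall>c. z c - bdmap K i 0 c \<in> I"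
        using I(2) by (simp add: linmap_0[OF linmap_bdmap] ideal.subspace_0)
      with z show ?thesis
        unfolding tensor_boundaries_def by (blast intro: graded_chains_0)
    next
      case False
      have "finite (msupp (\<mu> i) z)"
        using msupp_degree[OF K z] by (intro finite_subset[OF _ finite_mdeg[of j]]) auto
      then obtain M where M: "M \<in> msupp (\<mu> i) z" and M_max: "\<And>m. m \<in> msupp (\<mu> i) z \<Longrightarrow> \<not> lt M m"
        using Finite_Set.bex_max_element[of "msupp (\<mu> i) z" lt] False lt_irrefl lt_trans
        by (metis asymp_on_def transp_on_def)
      let ?P = "\<lambda>m. eqv m M"
      define zM where "zM = vrestr (\<mu> i) ?P z"
      have zMg: "zM \<in> graded_chains K i j" unfolding zM_def by (rule vrestr_graded[OF z])
      have "bdmap K l zM c \<in> leading_ideal lt I" if l: "i = Suc l" for l c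
      proof -
        have "\<not> lt M (a + \<mu> l c)" if "a \<in> keys (bdmap K l z c)" for a
          using that msuppI[of a "bdmap K l z" c "\<mu> l"] msupp_bdmap[OF K, of l z] M_max l by blast
        then have "restr (\<lambda>a. ?P (a + \<mu> l c)) (bdmap K l z c) \<in> leading_ideal lt I"
          by (rule top_class_in_leading_ideal[OF dz[OF l]])
        then show ?thesis
          using vrestr_bdmap[OF K, of l ?P z] by (simp add: zM_def l vrestr_def fun_eq_iff)
      qed
      then have "zM \<in> tensor_cycles (leading_ideal lt I) K i j"
        using zMg by (cases i) (auto simp: tensor_cycles_def)
      with ex obtain w where w: "w \<in> graded_chains K (Suc i) j"
        and wL: "\<And>c. zM c - bdmap K i w c \<in> leading_ideal lt I"
        by (auto simp: tensor_boundaries_def)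
      \<comment> \<open>The chain \<open>w\<close> may have terms outside the class of
        \<open>M\<close>, possibly above it. Its part in the class suffices: \<open>zM\<close> is
        its own part, so \<open>zM - d wM\<close> is the part of \<open>zM - d w\<close> in that
        class.\<close>
      define wM where "wM = vrestr (\<mu> (Suc i)) ?P w"
      have wMg: "wM \<in> graded_chains K (Suc i) j" unfolding wM_def by (rule vrestr_graded[OF w])
      have dwM: "bdmap K i wM = vrestr (\<mu> i) ?P (bdmap K i w)"
        unfolding wM_def by (rule vrestr_bdmap[OF K, symmetric])
      \<comment> \<open>Each coordinate of the error is lifted with its own shift
        \<open>\<mu> i c\<close>, so that \<open>M\<close> bounds the multidegrees of all the lifts
        at once.\<close>
      have "\<exists>u\<in>I. (\<forall>a\<in>keys u. \<not> lt M (a + \<mu> i c)) \<and>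
          (if c < rk K i then homogeneous (j - gdeg K i c) u else u = 0) \<and>
          restr (\<lambda>a. ?P (a + \<mu> i c)) u = zM c - bdmap K i wM c" for c
      proof (cases "c < rk K i")
        case True
        let ?e = "j - gdeg K i c"
        obtain u where u: "u \<in> I" "homogeneous ?e u" "\<forall>a\<in>keys u. \<not> lt M (a + \<mu> i c)"
          "restr (\<lambda>a. ?P (a + \<mu> i c)) u =
            restr (\<lambda>a. ?P (a + \<mu> i c) \<and> int (mdeg a) = ?e) (zM c - bdmap K i w c)"
          using leading_ideal_liftable[OF I wL] unfolding liftable_def by metis
        have "homogeneous ?e (zM c - bdmap K i w c)"
          using zMg w bd True by (auto simp: graded_chains_def graded_map_def intro: homogeneous_diff)
        then have "restr (\<lambda>a. ?P (a + \<mu> i c) \<and> int (mdeg a) = ?e) (zM c - bdmap K i w c)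
            = restr (\<lambda>a. ?P (a + \<mu> i c)) (zM c - bdmap K i w c)"
          by (intro restr_cong refl) (auto simp: homogeneous_def)
        also have "\<dots> = zM c - bdmap K i wM c"
          by (rule poly_mapping_eqI) (simp add: dwM zM_def vrestr_def lookup_restr lookup_minus)
        finally have "restr (\<lambda>a. ?P (a + \<mu> i c)) u = zM c - bdmap K i wM c" unfolding u(4) .
        then show ?thesis using u(1-3) True by (intro bexI[of _ u]) simp_all
      next
        case False
        then have "zM c = 0" "bdmap K i wM c = 0"
          using zMg by (auto simp: graded_chains_def chains_def bdmap_def)
        then show ?thesis using False I(2) by (intro bexI[of _ 0]) (auto simp: ideal.subspace_0)
      qed
      then obtain u where u: "\<And>c. u c \<in> I" "\<And>c a. a \<in> keys (u c) \<Longrightarrow> \<not> lt M (a + \<mu> i c)"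
        "\<And>c. if c < rk K i then homogeneous (j - gdeg K i c) (u c) else u c = 0"
        "\<And>c. restr (\<lambda>a. ?P (a + \<mu> i c)) (u c) = zM c - bdmap K i wM c"
        by metis
      have ug: "u \<in> graded_chains K i j"
        using u(3) unfolding graded_chains_def chains_def by (auto split: if_splits)
      \<comment> \<open>In the class of \<open>M\<close> the three chains contribute
        \<open>zM\<close>, \<open>d wM\<close> and \<open>zM - d wM\<close>, which cancel.
        Subtracting \<open>u\<close> keeps a cycle modulo \<open>I\<close>, as the coordinates of
        \<open>u\<close> lie in \<open>I\<close>.\<close>
      define z' where "z' = z - bdmap K i wM - u"
      have dwMg: "bdmap K i wM \<in> graded_chains K i j"
        using bd wMg by (simp add: graded_map_def)
      have z'g: "z' \<in> graded_chains K i j"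
        unfolding z'_def by (intro graded_chains_diff z ug dwMg)
      have "bdmap K l z' c \<in> I" if l: "i = Suc l" for l c
      proof -
        have "bdmap K l (bdmap K i wM) = 0"
          using resolution_bdmap_bdmap[OF res] graded_chains_chains[OF wMg] l by simp
        then have "bdmap K l z' c = bdmap K l z c - bdmap K l u c"
          by (simp add: z'_def linmap_diff[OF linmap_bdmap])
        moreover have "bdmap K l u c \<in> I"
          by (rule linmap_ideal[OF linmap_bdmap graded_chains_chains[OF ug] I(2) u(1)])
        ultimately show ?thesis using dz[OF l] I(2) by (simp add: ideal.subspace_diff)
      qed
      then have z'cyc: "z' \<in> tensor_cycles I K i j"
        using z'g by (cases i) (auto simp: tensor_cycles_def)
      have below: "lt m M" if mz: "m \<in> msupp (\<mu> i) z'" for m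
      proof -
        obtain a c where m: "m = a + \<mu> i c" and a: "a \<in> keys (z' c)"
          using mz by (auto simp: msupp_def)
        have "lookup (z' c) a = lookup (z c) a - lookup (bdmap K i wM c) a - lookup (u c) a"
          by (simp add: z'_def lookup_minus)
        then have "a \<in> keys (z c) \<or> a \<in> keys (bdmap K i wM c) \<or> a \<in> keys (u c)"
          using a by (auto simp: in_keys_iff)
        moreover have "\<not> lt M (a + \<mu> i c)" if "a \<in> keys (bdmap K i wM c)"
          using that by (simp add: dwM vrestr_def keys_restr eqv_def)
        ultimately have "\<not> lt M m"
          using M_max msuppI[of a z c "\<mu> i"] u(2) m by blast
        moreover have "\<not> ?P m"
        proof
          assume "?P m"
          have "restr (\<lambda>a. ?P (a + \<mu> i c)) (bdmap K i wM c) = bdmap K i wM c"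
            by (rule restr_id) (simp add: dwM vrestr_def keys_restr)
          then have "restr (\<lambda>a. ?P (a + \<mu> i c)) (z' c) = 0"
            by (simp add: z'_def restr_diff u(4)) (simp add: zM_def vrestr_def)
          then have "keys (restr (\<lambda>a. ?P (a + \<mu> i c)) (z' c)) = {}" by simp
          then show False using a m \<open>?P m\<close> by (auto simp: keys_restr)
        qed
        ultimately show ?thesis by (auto simp: eqv_def)
      qed
      have "N z' \<subset> N z"
      proof
        show "N z' \<subseteq> N z"
          unfolding N_def using below M lt_trans by blast
        have "M \<in> N z" using M msupp_degree[OF K z M] lt_irrefl by (auto simp: N_def)
        moreover have "M \<notin> N z'" using below by (auto simp: N_def)
        ultimately show "N z' \<noteq> N z" by blast
      qed
      then have "card (N z') < card (N z)" by (rule psubset_card_mono[OF finN])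
      then have "z' \<in> tensor_boundaries I K i j" using less.hyps z'cyc by blast
      then obtain w' where w': "w' \<in> graded_chains K (Suc i) j" "\<And>c. z' c - bdmap K i w' c \<in> I"
        by (auto simp: tensor_boundaries_def)
      have "z c - bdmap K i (w' + wM) c = (z' c - bdmap K i w' c) + u c" for c
        by (simp add: z'_def linmap_add[OF linmap_bdmap])
      then have "z c - bdmap K i (w' + wM) c \<in> I" for c
        using w'(2) u(1) I(2) by (simp only: ideal.subspace_add)
      then show ?thesis
        using z graded_chains_add[OF w'(1) wMg] unfolding tensor_boundaries_def by blast
    qed
  qed
qed

end


section \<open>A multigraded resolution of the residue field\<close>

text \<open>The resolution below is a variant of Taylor's on ordered sequences of variables, possibly with
  repetitions; it is not minimal, but no signs of permutations occur. The following is the boundary map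
  of the chain complex of all vertex sequences in a full simplex, in terms of
  coefficients: the value at \<open>ys\<close> collects, with signs, the coefficients of the sequences from which
  \<open>ys\<close> arises by deleting one entry.\<close>

primrec bdry :: "'v::finite list \<Rightarrow> ('v list \<Rightarrow> 'a::ab_group_add) \<Rightarrow> 'a" where
  "bdry [] Z = (\<Sum>u\<in>UNIV. Z [u])"
| "bdry (y # ys) Z = (\<Sum>u\<in>UNIV. Z (u # y # ys)) - bdry ys (\<lambda>xs. Z (y # xs))"

lemma bdry_cong:
  "(\<And>xs. length xs = Suc (length ys) \<Longrightarrow> set ys \<subseteq> set xs \<Longrightarrow> Z xs = Z' xs) \<Longrightarrow> bdry ys Z = bdry ys Z'"
proof (induction ys arbitrary: Z Z')
  case Nil
  then show ?case by simp
next
  case (Cons y ys)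
  have "bdry ys (\<lambda>xs. Z (y # xs)) = bdry ys (\<lambda>xs. Z' (y # xs))"
    by (rule Cons.IH) (auto intro!: Cons.prems)
  moreover have "Z (u # y # ys) = Z' (u # y # ys)" for u by (rule Cons.prems) auto
  ultimately show ?case by simp
qed

lemma bdry_sum: "bdry ys (\<lambda>xs. \<Sum>t\<in>T. Z t xs) = (\<Sum>t\<in>T. bdry ys (Z t))"
proof (induction ys arbitrary: Z)
  case Nil
  show ?case using sum.swap by fastforce
next
  case (Cons y ys)
  have "(\<Sum>u\<in>UNIV. \<Sum>t\<in>T. Z t (u # y # ys)) = (\<Sum>t\<in>T. \<Sum>u\<in>UNIV. Z t (u # y # ys))"
    by (rule sum.swap)
  then show ?case by (simp add: Cons sum_subtractf)
qed

lemma bdry_diff: "bdry ys (\<lambda>xs. Z xs - Z' xs) = bdry ys Z - bdry ys Z'"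
  by (induction ys arbitrary: Z Z') (simp_all add: sum_subtractf)

lemma bdry_hom:
  assumes "\<And>x y. h (x + y) = h x + h y"
  shows "bdry ys (\<lambda>xs. h (Z xs)) = h (bdry ys Z)"
proof -
  interpret additive h by unfold_locales (rule assms)
  show ?thesis by (induction ys arbitrary: Z) (simp_all add: sum diff)
qed

lemma bdry_0: "bdry ys (\<lambda>_. 0) = 0"
  using bdry_sum[of ys "\<lambda>_ _. 0" "{}"] by simp

text \<open>Of the pairs of inserted entries, those with both in front cancel by exchanging the two,
  those with exactly one in front cancel by opposite signs, and the remaining ones are the induction
  hypothesis.\<close>

lemma bdry_bdry: "bdry ys (\<lambda>xs. bdry xs Z) = 0"
proof (induction ys arbitrary: Z)
  case Nil
  have "(\<Sum>u\<in>UNIV. \<Sum>t\<in>UNIV. Z [t, u]) = (\<Sum>u\<in>UNIV. \<Sum>t\<in>UNIV. Z [u, t])"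
    by (rule sum.swap)
  then show ?case by (simp add: sum_subtractf)
next
  case (Cons y ys)
  have swap: "(\<Sum>u\<in>UNIV. \<Sum>t\<in>UNIV. Z (t # u # y # ys)) = (\<Sum>u\<in>UNIV. \<Sum>t\<in>UNIV. Z (u # t # y # ys))"
    by (rule sum.swap)
  have "bdry ys (\<lambda>xs. bdry (y # xs) Z) =
      (\<Sum>t\<in>UNIV. bdry ys (\<lambda>xs. Z (t # y # xs))) - bdry ys (\<lambda>xs. bdry xs (\<lambda>xs. Z (y # xs)))"
    by (simp add: bdry_diff bdry_sum)
  then show ?case by (simp add: Cons sum_subtractf swap)
qed

text \<open>The coefficient of \<open>ys\<close> in the simplicial boundary of \<open>xs\<close>.
  With repeated entries several deletions may yield the same \<open>ys\<close>, and their signs add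
  up.\<close>

definition inc :: "'v::finite list \<Rightarrow> 'v list \<Rightarrow> 'k::field" where
  "inc ys xs = bdry ys (\<lambda>x. if x = xs then 1 else 0)"

lemma inc_nonzero:
  assumes "inc ys xs \<noteq> (0 :: 'k::field)"
  shows "set ys \<subseteq> set xs \<and> length xs = Suc (length ys)"
proof (rule ccontr)
  assume "\<not> ?thesis"
  then have "inc ys xs = bdry ys (\<lambda>_. 0 :: 'k)" unfolding inc_def by (intro bdry_cong) auto
  with assms show False by (simp add: bdry_0)
qed

lemma finite_lists_length: "finite {xs :: 'v::finite list. length xs = i}"
  using finite_lists_length_eq[of "UNIV :: 'v set" i] by simp

lemma bdry_expansion:
  fixes Z :: "'v::finite list \<Rightarrow> ('n, 'k::field) mpoly"
  shows "bdry ys Z = (\<Sum>xs | length xs = Suc (length ys). single 0 (inc ys xs) * Z xs)"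
proof -
  let ?X = "{xs :: 'v list. length xs = Suc (length ys)}"
  have "bdry ys Z = bdry ys (\<lambda>x. \<Sum>xs\<in>?X. if x = xs then Z xs else 0)"
    by (rule bdry_cong) (simp add: finite_lists_length)
  also have "\<dots> = (\<Sum>xs\<in>?X. bdry ys (\<lambda>x. if x = xs then Z xs else 0))"
    by (rule bdry_sum)
  also have "\<dots> = (\<Sum>xs\<in>?X. single 0 (inc ys xs) * Z xs)"
  proof (rule sum.cong[OF refl])
    fix xs
    have "bdry ys (\<lambda>x. if x = xs then Z xs else 0) = bdry ys (\<lambda>x. single 0 (if x = xs then 1 else 0) * Z xs)"
      by (rule bdry_cong) simp
    also have "\<dots> = single 0 (inc ys xs) * Z xs"
      unfolding inc_def by (rule bdry_hom[of "\<lambda>c. single 0 c * Z xs"]) (simp add: single_add distrib_right)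
    finally show "bdry ys (\<lambda>x. if x = xs then Z xs else 0) = single 0 (inc ys xs) * Z xs" .
  qed
  finally show ?thesis .
qed

text \<open>The exponent of the least common multiple of the variables in \<open>xs\<close>, as in
  Taylor's resolution; a repeated variable counts once.\<close>

definition ind :: "'n list \<Rightarrow> 'n monom" where
  "ind xs = (\<Sum>v\<in>set xs. single v 1)"

lemma lookup_ind: "lookup (ind xs) v = (if v \<in> set xs then 1 else 0)"
  by (auto simp: ind_def lookup_sum lookup_single when_def)

lemma ind_Nil [simp]: "ind [] = 0"
  by (simp add: ind_def)

lemma ind_diff_add: "set ys \<subseteq> set xs \<Longrightarrow> ind xs - ind ys + ind ys = ind xs"
  by (rule poly_mapping_eqI) (auto simp: lookup_add lookup_minus lookup_ind)

lemma sum_restr: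
  fixes f :: "'a \<Rightarrow>\<^sub>0 'b::comm_monoid_add"
  shows "(\<Sum>u\<in>(UNIV :: 'c::finite set). restr (\<lambda>m. g m = u) f) = f"
  by (rule poly_mapping_eqI) (simp add: lookup_sum lookup_restr)

lemma lookup_single_mult:
  fixes f :: "('n, 'k::field) mpoly"
  shows "lookup (single m 1 * f) (m + a) = lookup f a"
proof -
  have "single m 1 * f = (\<Sum>b\<in>keys f. single (m + b) (lookup f b))"
    by (subst (1) sum_singles[of f, symmetric]) (simp only: sum_distrib_left mult_single mult_1)
  then show ?thesis by (simp add: lookup_sum lookup_single when_def in_keys_iff)
qed

lemma single_mult_cancel:
  fixes f g :: "('n, 'k::field) mpoly"
  assumes "single m 1 * f = single m 1 * g"
  shows "f = g"
  using assms by (metis lookup_single_mult poly_mapping_eqI)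

lemma single_dvdI:
  fixes f :: "('n, 'k::field) mpoly"
  assumes "\<And>a. a \<in> keys f \<Longrightarrow> m + (a - m) = a"
  shows "\<exists>g. f = single m 1 * g"
proof
  have "single m 1 * (\<Sum>a\<in>keys f. single (a - m) (lookup f a)) = (\<Sum>a\<in>keys f. single a (lookup f a))"
    unfolding sum_distrib_left by (rule sum.cong) (simp_all add: mult_single assms)
  then show "f = single m 1 * (\<Sum>a\<in>keys f. single (a - m) (lookup f a))"
    by (simp only: sum_singles)
qed

section \<open>The complex on sequences of variables and its exactness\<close>

definition list_at :: "nat \<Rightarrow> nat \<Rightarrow> 'v::finite list" where
  "list_at i = (SOME f. bij_betw f {..<card {xs :: 'v list. length xs = i}} {xs. length xs = i})"

definition list_index :: "'v::finite list \<Rightarrow> nat" where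
  "list_index xs = inv_into {..<card {ys :: 'v list. length ys = length xs}} (list_at (length xs)) xs"

lemma list_at_bij:
  "bij_betw (list_at i) {..<card {xs :: 'v::finite list. length xs = i}} {xs :: 'v list. length xs = i}"
  unfolding list_at_def
  using ex_bij_betw_nat_finite[OF finite_lists_length[where 'v = 'v and i = i]]
  unfolding atLeast0LessThan by (rule someI_ex)

text \<open>Subtraction of exponents truncates, but it is exact wherever \<open>inc\<close> is
  nonzero, by the inclusion of sets in \<open>inc_nonzero\<close>. The only basis element in
  homological degree 0 is the empty sequence, of multidegree 0, which is sent to 1.\<close>

definition taylor :: "('n::finite, 'k::field) mpoly free_complex" where
  "taylor = \<lparr>rk = (\<lambda>i. card {xs :: 'n list. length xs = i}),
    gdeg = (\<lambda>i b. int (mdeg (ind (list_at i b :: 'n list)))),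
    entry = (\<lambda>i c b. single (ind (list_at (Suc i) b) - ind (list_at i c)) (inc (list_at i c) (list_at (Suc i) b :: 'n list))),
    aug = (\<lambda>_. 1)\<rparr>"

context
  fixes T :: "('n::finite, 'k::field) mpoly free_complex"
  defines "T \<equiv> taylor"
begin

lemma length_list_at: "b < rk T i \<Longrightarrow> length (list_at i b :: 'n list) = i"
  using list_at_bij[where 'v = 'n and i = i] by (auto simp: T_def taylor_def bij_betw_def)

lemma list_index_list_at: "b < rk T i \<Longrightarrow> list_index (list_at i b :: 'n list) = b"
  using bij_betw_inv_into_left[OF list_at_bij[where 'v = 'n and i = i], of b] length_list_at[of b i]
  by (simp add: T_def taylor_def list_index_def)

lemma list_at_list_index: "list_at (length xs) (list_index xs) = (xs :: 'n list)"
  using bij_betw_inv_into_right[OF list_at_bij[where 'v = 'n and i = "length xs"], of xs]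
  by (simp add: list_index_def)

lemma list_index_less: "list_index (xs :: 'n list) < rk T (length xs)"
  using bij_betw_inv_into[OF list_at_bij[where 'v = 'n and i = "length xs"]]
  by (auto simp: T_def taylor_def list_index_def bij_betw_def)

lemma sum_list_at: "(\<Sum>b<rk T i. g (list_at i b :: 'n list)) = (\<Sum>xs | length xs = i. g xs)"
  using sum.reindex_bij_betw[OF list_at_bij[where 'v = 'n and i = i], of g]
  by (simp add: T_def taylor_def)

text \<open>Multiplying the coordinate at \<open>xs\<close> by \<open>x^(ind xs)\<close> is
  injective and turns the differential into \<open>bdry\<close>, whose coefficients are constants.
  The monomials survive only as the condition that \<open>x^(ind xs)\<close> divides the value at
  \<open>xs\<close>.\<close>

definition shift :: "(nat \<Rightarrow> ('n, 'k) mpoly) \<Rightarrow> 'n list \<Rightarrow> ('n, 'k) mpoly" where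
  "shift z xs = single (ind xs) 1 * z (list_index xs)"

lemma shift_bdmap: "shift (bdmap T i z) ys = bdry ys (shift z)" if ys: "length ys = i"
proof -
  have c: "list_index ys < rk T i" "list_at i (list_index ys) = ys"
    using list_index_less[of ys] list_at_list_index[of ys] ys by auto
  have "shift (bdmap T i z) ys =
      (\<Sum>b<rk T (Suc i). single (ind ys) 1 * (entry T i (list_index ys) b * z b))"
    using c(1) by (simp add: shift_def bdmap_def sum_distrib_left)
  also have "\<dots> = (\<Sum>b<rk T (Suc i). single 0 (inc ys (list_at (Suc i) b)) * shift z (list_at (Suc i) b))"
  proof (rule sum.cong[OF refl])
    fix b assume "b \<in> {..<rk T (Suc i)}"
    then have b: "list_index (list_at (Suc i) b :: 'n list) = b" by (simp add: list_index_list_at)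
    let ?xs = "list_at (Suc i) b :: 'n list"
    have "single (ind ys) 1 * entry T i (list_index ys) b = single 0 (inc ys ?xs) * single (ind ?xs) (1 :: 'k)"
    proof (cases "inc ys ?xs = (0 :: 'k)")
      case False
      then have "ind ys + (ind ?xs - ind ys) = ind ?xs"
        using inc_nonzero ind_diff_add by (metis add.commute)
      then show ?thesis by (simp add: T_def taylor_def c(2)[unfolded T_def] mult_single)
    qed (simp add: T_def taylor_def c(2))
    then show "single (ind ys) 1 * (entry T i (list_index ys) b * z b) =
        single 0 (inc ys ?xs) * shift z ?xs"
      by (simp add: shift_def b mult.assoc[symmetric])
  qed
  also have "\<dots> = (\<Sum>xs | length xs = Suc i. single 0 (inc ys xs) * shift z xs)"
    by (rule sum_list_at)
  also have "\<dots> = bdry ys (shift z)" by (simp add: bdry_expansion ys)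
  finally show ?thesis .
qed

lemma shift_eqI:
  assumes "z \<in> chains T i" "w \<in> chains T i" "\<And>xs. length xs = i \<Longrightarrow> shift z xs = shift w xs"
  shows "z = w"
proof
  fix b
  show "z b = w b"
  proof (cases "b < rk T i")
    case True
    then have "single (ind (list_at i b :: 'n list)) 1 * z b = single (ind (list_at i b :: 'n list)) 1 * w b"
      using assms(3)[OF length_list_at[OF True]] by (simp add: shift_def list_index_list_at)
    then show ?thesis by (rule single_mult_cancel)
  qed (use assms(1,2) in \<open>simp add: chains_def\<close>)
qed

lemma bdmap_chain: "bdmap T i z \<in> chains T i"
  by (simp add: bdmap_def chains_def)

lemma taylor_bdmap_bdmap: "bdmap T i (bdmap T (Suc i) z) = 0"
proof (rule shift_eqI[OF bdmap_chain chains_0])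
  fix ys :: "'n list" assume ys: "length ys = i"
  have "shift (bdmap T i (bdmap T (Suc i) z)) ys = bdry ys (\<lambda>xs. bdry xs (shift z))"
    unfolding shift_bdmap[OF ys] by (rule bdry_cong) (simp add: shift_bdmap ys)
  then show "shift (bdmap T i (bdmap T (Suc i) z)) ys = shift 0 ys"
    by (simp add: bdry_bdry) (simp add: shift_def)
qed

text \<open>The contracting homotopy prepends to a sequence a variable that divides the monomial.\<close>

lemma taylor_exact:
  assumes z: "z \<in> chains T i"
    and cyc: "case i of 0 \<Rightarrow> lookup (z 0) 0 = 0 | Suc l \<Rightarrow> bdmap T l z = 0"
  shows "\<exists>w\<in>chains T (Suc i). bdmap T i w = z"
proof -
  define sel where "sel m = (SOME v. lookup m v \<noteq> 0)" for m :: "'n monom"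
  have sel: "lookup m (sel m) \<noteq> 0" if "m \<noteq> 0" for m
    unfolding sel_def by (rule someI_ex) (metis that lookup_zero poly_mapping_eqI)
  \<comment> \<open>The homotopy: each monomial of the value at \<open>tl xs\<close> is moved to the
    sequence with its selected variable in front, so that summing over the first entry returns the
    whole value.\<close>
  define W where "W xs = restr (\<lambda>m. sel m = hd xs) (shift z (tl xs))" for xs
  have "\<exists>g. W xs = single (ind xs) 1 * g" if xs: "length xs = Suc i" for xs
  proof (rule single_dvdI)
    fix a assume "a \<in> keys (W xs)"
    then have a: "a \<in> keys (shift z (tl xs))" and hd: "sel a = hd xs"
      by (auto simp: W_def keys_restr)
    have a': "\<exists>b. a = ind (tl xs) + b"
      using a keys_mult[of "single (ind (tl xs)) 1" "z (list_index (tl xs))"]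
      by (auto simp: shift_def split: if_splits)
    \<comment> \<open>The value of \<open>sel\<close> at the monomial 1 is arbitrary, so this
      monomial must be excluded: for \<open>i = 0\<close> by the assumption on the constant term,
      otherwise because the variables of \<open>tl xs\<close> divide the monomial.\<close>
    have "a \<noteq> 0"
    proof (cases i)
      case 0
      then have tl: "tl xs = []" using xs by (cases xs) auto
      have "list_index ([] :: 'n list) = 0"
        using list_index_less[of "[]"] by (simp add: T_def taylor_def)
      with a have "a \<in> keys (z 0)" by (simp add: shift_def tl)
      with cyc 0 show ?thesis by (auto simp: in_keys_iff)
    next
      case (Suc l)
      then have "tl xs \<noteq> []" using xs by (cases xs) auto
      then have "lookup (ind (tl xs)) (hd (tl xs)) \<noteq> 0" by (simp add: lookup_ind)
      moreover obtain b where "a = ind (tl xs) + b" using a' ..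
      ultimately have "lookup a (hd (tl xs)) \<noteq> 0" by (simp add: lookup_add)
      then show ?thesis by auto
    qed
    then have "lookup a (hd xs) \<noteq> 0" using sel hd by metis
    moreover have "lookup a v \<noteq> 0" if "v \<in> set (tl xs)" for v
      using a' that by (auto simp: lookup_add lookup_ind)
    moreover have "set xs = insert (hd xs) (set (tl xs))" using xs by (cases xs) auto
    ultimately show "ind xs + (a - ind xs) = a"
      by (intro poly_mapping_eqI) (auto simp: lookup_add lookup_minus lookup_ind)
  qed
  then obtain G where G: "\<And>xs. length xs = Suc i \<Longrightarrow> W xs = single (ind xs) 1 * G xs" by metis
  define w where "w b = (if b < rk T (Suc i) then G (list_at (Suc i) b) else 0)" for b
  have w: "w \<in> chains T (Suc i)" by (simp add: w_def chains_def)
  have shift_w: "shift w xs = W xs" if "length xs = Suc i" for xs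
    using list_index_less[of xs] list_at_list_index[of xs] G[OF that] that
    by (simp add: shift_def w_def)
  have "bdmap T i w = z"
  proof (rule shift_eqI[OF bdmap_chain z])
    fix ys :: "'n list" assume ys: "length ys = i"
    have "shift (bdmap T i w) ys = bdry ys W"
      unfolding shift_bdmap[OF ys] by (rule bdry_cong) (simp add: shift_w ys)
    also have "\<dots> = shift z ys"
    proof (cases ys)
      case Nil
      then show ?thesis by (simp add: W_def sum_restr)
    next
      case (Cons y ys')
      then have l: "i = Suc (length ys')" using ys by simp
      \<comment> \<open>This is the second term of \<open>bdry\<close> at \<open>y # ys'\<close>.
        Restriction is additive, hence passes through \<open>bdry\<close>, and the term vanishes as
        \<open>z\<close> is a cycle; the sum over first entries remains.\<close>
      have "bdry ys' (\<lambda>xs. restr (\<lambda>m. sel m = y) (shift z xs)) = restr (\<lambda>m. sel m = y) (bdry ys' (shift z))"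
        by (rule bdry_hom) (rule restr_add)
      also have "bdry ys' (shift z) = 0"
        using shift_bdmap[of ys' "length ys'" z] cyc l by (simp add: shift_def)
      finally show ?thesis by (simp add: Cons W_def sum_restr)
    qed
    finally show "shift (bdmap T i w) ys = shift z ys" .
  qed
  with w show ?thesis by blast
qed

lemma irrelevant_ideal_lookup:
  assumes "f \<in> (irrelevant_ideal :: ('n, 'k) mpoly set)"
  shows "lookup f 0 = 0"
  using assms unfolding irrelevant_ideal_def
proof (induction rule: ideal.span_induct_alt)
  case (step c x y)
  then obtain v where x: "x = single (single v 1) 1" by auto
  have "0 \<notin> keys (c * x)"
  proof
    assume "0 \<in> keys (c * x)"
    then obtain a where "0 = a + single v (1 :: nat)"
      using keys_mult[of c x] by (auto simp: x)
    then have "lookup (a + single v (1 :: nat)) v = 0" by (metis lookup_zero)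
    then show False by (simp add: lookup_add)
  qed
  with step show ?case by (simp add: lookup_add in_keys_iff)
qed simp

lemma multigraded_entry:
  assumes "a \<in> keys (entry T i c b)"
  shows "a + ind (list_at i c) = ind (list_at (Suc i) b :: 'n list)"
  using assms inc_nonzero[of "list_at i c :: 'n list" "list_at (Suc i) b", where 'k = 'k]
  by (auto simp: T_def taylor_def ind_diff_add split: if_splits)

lemma multigraded_taylor: "multigraded T (\<lambda>i b. ind (list_at i b))"
  using multigraded_entry unfolding multigraded_def by (auto simp: T_def taylor_def)

lemma rk_taylor_0: "rk T 0 = 1"
  by (simp add: T_def taylor_def)

lemma taylor_resolution: "graded_free_resolution irrelevant_ideal T"
proof -
  have aug: "augment T z = z 0" for z
    by (simp add: augment_def rk_taylor_0) (simp add: T_def taylor_def)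
  have gdeg: "gdeg T i b = int (mdeg (ind (list_at i b :: 'n list)))" for i b
    by (simp add: T_def taylor_def)
  have "homogeneous (gdeg T 0 b) (aug T b)" if "b < rk T 0" for b
    using length_list_at[OF that] by (simp add: gdeg mdeg_def) (simp add: T_def taylor_def homogeneous_1)
  moreover have "homogeneous (gdeg T (Suc i) b - gdeg T i c) (entry T i c b)" for i c b
    unfolding homogeneous_def gdeg by (metis multigraded_entry mdeg_add add_diff_cancel_right' of_nat_add)
  moreover have "\<exists>z\<in>chains T 0. f - augment T z \<in> irrelevant_ideal" for f
    by (rule bexI[of _ "\<lambda>b. if b = 0 then f else 0"])
       (auto simp: aug chains_def rk_taylor_0 irrelevant_ideal_def ideal.span_zero)
  \<comment> \<open>The argument is a circle: members of the irrelevant ideal have no constant term,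
    \<open>taylor_exact\<close> turns this into being a boundary, and boundaries lie in the ideal
    since the entries of the first matrix are multiples of variables.\<close>
  moreover have "{z \<in> chains T 0. augment T z \<in> irrelevant_ideal} = bdmap T 0 ` chains T 1"
  proof (intro equalityI subsetI)
    fix z assume "z \<in> {z \<in> chains T 0. augment T z \<in> irrelevant_ideal}"
    then have "z \<in> chains T 0" "lookup (z 0) 0 = 0" using irrelevant_ideal_lookup by (auto simp: aug)
    then show "z \<in> bdmap T 0 ` chains T 1" using taylor_exact[of z 0] by auto
  next
    fix z assume "z \<in> bdmap T 0 ` chains T 1"
    then obtain w where w: "z = bdmap T 0 w" by blast
    have "entry T 0 0 b * w b \<in> irrelevant_ideal" if b: "b < rk T (Suc 0)" for b
    proof -
      obtain v :: 'n where v: "list_at (Suc 0) b = [v]"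
        using length_list_at[OF b] by (auto simp: length_Suc_conv)
      have nil: "list_at 0 0 = ([] :: 'n list)" using length_list_at[of 0 0] by (simp add: rk_taylor_0)
      have "entry T 0 0 b = single 0 (inc [] [v]) * single (single v 1) 1"
        by (simp add: T_def taylor_def v nil mult_single ind_def)
      then have "entry T 0 0 b * w b = (single 0 (inc [] [v]) * w b) * single (single v 1) 1"
        by (simp add: mult_ac)
      then show ?thesis unfolding irrelevant_ideal_def
        by (simp only:) (rule ideal.span_scale, rule ideal.span_base, rule rangeI)
    qed
    then have "z 0 \<in> irrelevant_ideal"
      unfolding irrelevant_ideal_def by (auto simp: w bdmap_def rk_taylor_0 intro: ideal.span_sum)
    then show "z \<in> {z \<in> chains T 0. augment T z \<in> irrelevant_ideal}"
      using bdmap_chain by (simp add: aug w)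
  qed
  moreover have "{z \<in> chains T (Suc i). bdmap T i z = 0} = bdmap T (Suc i) ` chains T (Suc (Suc i))" for i
    using taylor_exact[of _ "Suc i"] taylor_bdmap_bdmap bdmap_chain by (auto simp: image_iff)
  ultimately show ?thesis unfolding graded_free_resolution_def by blast
qed

end


section \<open>Betti numbers\<close>

text \<open>Subtraction truncates, so the left side says that \<open>dim Z\<close> is at most
  \<open>dim B\<close>. A vector of \<open>Z\<close> outside \<open>B\<close> would extend a basis
  of \<open>B\<close> to an independent set too large for the span of a basis of \<open>Z\<close>.
  The finite \<open>S\<close> excludes infinite bases, whose cardinality counts as 0.\<close>

lemma (in vector_space) dim_diff_eq_0_iff:
  assumes "B \<subseteq> Z" "subspace B" "Z \<subseteq> span S" "finite S"
  shows "dim Z - dim B = 0 \<longleftrightarrow> Z \<subseteq> B"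
proof
  assume le: "dim Z - dim B = 0"
  obtain b where b: "b \<subseteq> B" "independent b" "B \<subseteq> span b" "card b = dim B"
    using basis_exists[of B] by metis
  obtain c where c: "c \<subseteq> Z" "independent c" "Z \<subseteq> span c" "card c = dim Z"
    using basis_exists[of Z] by metis
  have fin: "finite b" "finite c"
    using independent_span_bound[OF assms(4)] b c assms(1,3) by (meson subset_trans)+
  show "Z \<subseteq> B"
  proof
    fix z assume z: "z \<in> Z"
    show "z \<in> B"
    proof (rule ccontr)
      assume "z \<notin> B"
      then have "z \<notin> span b" using span_minimal[OF b(1) assms(2)] by blast
      then have "independent (insert z b)" "z \<notin> b"
        using b(2) independent_insertI span_base by auto
      moreover have "insert z b \<subseteq> span c" using z b(1) c(3) assms(1) by blast
      ultimately have "card (insert z b) \<le> card c" using independent_span_bound[OF fin(2)] by blast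
      then show False using \<open>z \<notin> b\<close> fin(1) b(4) c(4) le by simp
    qed
  qed
next
  assume "Z \<subseteq> B"
  then have "Z = B" using assms(1) by blast
  then show "dim Z - dim B = 0" by simp
qed

lemma graded_chains_finite_span:
  "\<exists>S. finite S \<and> graded_chains F i j \<subseteq> poly_vec.span (S :: (nat \<Rightarrow> ('n::finite, 'k::field) mpoly) set)"
proof (intro exI conjI)
  let ?e = "\<lambda>b a b'. if b' = b then single a 1 else (0 :: ('n, 'k) mpoly)"
  let ?S = "\<Union>b<rk F i. ?e b ` {a. int (mdeg a) = j - gdeg F i b}"
  show "finite ?S" using finite_mdeg by blast
  show "graded_chains F i j \<subseteq> poly_vec.span ?S"
  proof
    fix z assume z: "z \<in> graded_chains F i j"
    have "z = (\<Sum>b<rk F i. \<Sum>a\<in>keys (z b). vscale (lookup (z b) a) (?e b a))"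
    proof
      fix c
      have "(\<Sum>a\<in>keys (z b). vscale (lookup (z b) a) (?e b a)) c = (if b = c then z c else 0)" for b
        by (auto simp: sum_fun_apply vscale_def mult_single sum_singles)
      then show "z c = (\<Sum>b<rk F i. \<Sum>a\<in>keys (z b). vscale (lookup (z b) a) (?e b a)) c"
        using z by (auto simp: sum_fun_apply[of _ "{..<rk F i}"] graded_chains_def chains_def)
    qed
    also have "\<dots> \<in> poly_vec.span ?S"
    proof (intro poly_vec.span_sum poly_vec.span_scale poly_vec.span_base)
      fix b a assume b: "b \<in> {..<rk F i}" and a: "a \<in> keys (z b)"
      then have "int (mdeg a) = j - gdeg F i b"
        using z by (auto simp: graded_chains_def homogeneous_def)
      with b show "?e b a \<in> ?S" by blast
    qed
    finally show "z \<in> poly_vec.span ?S" .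
  qed
qed

lemma graded_chains_vscale:
  fixes z :: "nat \<Rightarrow> ('n::finite, 'k::field) mpoly"
  assumes "z \<in> graded_chains F i j"
  shows "vscale c z \<in> graded_chains F i j"
proof -
  have "homogeneous d (single 0 c * f)" if "homogeneous d f" for d and f :: "('n, 'k) mpoly"
    by (rule homogeneous_mult[OF homogeneous_single that]) (auto simp: mdeg_def)
  then show ?thesis using assms by (simp add: graded_chains_def chains_def vscale_def)
qed

lemma subspace_tensor_boundaries:
  assumes I: "ideal.subspace I"
  shows "poly_vec.subspace (tensor_boundaries I F i j)"
proof (rule poly_vec.subspaceI)
  have "0 c - bdmap F i 0 c \<in> I" for c
    using I by (simp add: linmap_0[OF linmap_bdmap] ideal.subspace_0)
  then show "0 \<in> tensor_boundaries I F i j"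
    unfolding tensor_boundaries_def using graded_chains_0 by blast
next
  fix x y assume "x \<in> tensor_boundaries I F i j" "y \<in> tensor_boundaries I F i j"
  then obtain v w where xy: "x \<in> graded_chains F i j" "y \<in> graded_chains F i j"
    and vw: "v \<in> graded_chains F (Suc i) j" "w \<in> graded_chains F (Suc i) j"
    "\<And>c. x c - bdmap F i v c \<in> I" "\<And>c. y c - bdmap F i w c \<in> I"
    by (auto simp: tensor_boundaries_def)
  have "(x + y) c - bdmap F i (v + w) c = (x c - bdmap F i v c) + (y c - bdmap F i w c)" for c
    by (simp add: linmap_add[OF linmap_bdmap])
  then have "(x + y) c - bdmap F i (v + w) c \<in> I" for c
    using vw I by (simp only: ideal.subspace_add)
  then show "x + y \<in> tensor_boundaries I F i j"
    unfolding tensor_boundaries_def using graded_chains_add xy vw(1,2) by blast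
next
  fix r x assume "x \<in> tensor_boundaries I F i j"
  then obtain v where x: "x \<in> graded_chains F i j" and v: "v \<in> graded_chains F (Suc i) j"
    "\<And>c. x c - bdmap F i v c \<in> I"
    by (auto simp: tensor_boundaries_def)
  have "vscale r x c - bdmap F i (vscale r v) c = single 0 r * (x c - bdmap F i v c)" for c
    by (simp add: vscale_def linmap_scale[OF linmap_bdmap] right_diff_distrib)
  then have "vscale r x c - bdmap F i (vscale r v) c \<in> I" for c
    using v(2) I by (simp only: ideal.subspace_scale)
  then show "vscale r x \<in> tensor_boundaries I F i j"
    unfolding tensor_boundaries_def using graded_chains_vscale x v(1) by blast
qed

lemma tensor_boundaries_cycles:
  assumes res: "graded_free_resolution J F" and I: "ideal.subspace I"
  shows "tensor_boundaries I F i j \<subseteq> tensor_cycles I F i j"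
proof
  fix z assume "z \<in> tensor_boundaries I F i j"
  then obtain w where z: "z \<in> graded_chains F i j" and w: "w \<in> graded_chains F (Suc i) j"
    "\<And>c. (z - bdmap F i w) c \<in> I"
    by (auto simp: tensor_boundaries_def)
  note wc = graded_chains_chains[OF w(1)]
  have dw: "bdmap F i w \<in> chains F i"
    using resolution_bdmap_graded[OF res] wc by (simp add: graded_map_def)
  have "bdmap F l z c \<in> I" if l: "i = Suc l" for l c
  proof -
    have "bdmap F l (z - bdmap F i w) c \<in> I"
      by (rule linmap_ideal[OF linmap_bdmap chains_diff[OF graded_chains_chains[OF z] dw] I w(2)])
    then show ?thesis
      using resolution_bdmap_bdmap[OF res, of w l] wc by (simp add: linmap_diff[OF linmap_bdmap] l)
  qed
  then show "z \<in> tensor_cycles I F i j" using z by (cases i) (auto simp: tensor_cycles_def)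
qed

lemma homogeneous_irrelevant_ideal: "homogeneous_ideal (irrelevant_ideal :: ('n::finite, 'k::field) mpoly set)"
  unfolding homogeneous_ideal_def irrelevant_ideal_def
  by (rule exI) (rule conjI[OF _ refl], auto intro: homogeneous_single)

text \<open>The choice made in \<open>tor_dim\<close> is opaque, but \<open>taylor\<close> shows
  that it does yield a resolution, and transfer of vanishing in both directions allows it to be
  replaced by \<open>taylor\<close>.\<close>

lemma betti_eq_0_iff:
  fixes I :: "('n::finite, 'k::field) mpoly set"
  assumes I: "ideal.subspace I"
  shows "betti I i j = 0 \<longleftrightarrow> tensor_cycles I taylor i j \<subseteq> tensor_boundaries I taylor i j"
proof -
  let ?J = "irrelevant_ideal :: ('n, 'k) mpoly set"
  define F where "F = (SOME F. graded_free_resolution ?J F)"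
  have T: "graded_free_resolution ?J taylor" by (rule taylor_resolution)
  have F: "graded_free_resolution ?J F" unfolding F_def using T by (rule someI)
  have J: "ideal.subspace ?J" by (simp add: irrelevant_ideal_def)
  note transfer = tensor_exact_transfer[OF _ _ homogeneous_irrelevant_ideal J I]
  obtain S where S: "finite S" "graded_chains F i j \<subseteq> poly_vec.span S"
    using graded_chains_finite_span by metis
  have "tensor_cycles I F i j \<subseteq> poly_vec.span S"
    using S(2) by (auto simp: tensor_cycles_def)
  then have "betti I i j = 0 \<longleftrightarrow> tensor_cycles I F i j \<subseteq> tensor_boundaries I F i j"
    unfolding betti_def tor_dim_def F_def[symmetric] Let_def
    by (rule poly_vec.dim_diff_eq_0_iff[OF tensor_boundaries_cycles[OF F I]
          subspace_tensor_boundaries[OF I] _ S(1)])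
  also have "\<dots> \<longleftrightarrow> tensor_cycles I taylor i j \<subseteq> tensor_boundaries I taylor i j"
    using transfer[OF F T] transfer[OF T F] by blast
  finally show ?thesis .
qed

lemma betti_leading_ideal:
  fixes I :: "('n::finite, 'k::field) mpoly set"
  assumes "monomial_preorder lt" "homogeneous_ideal I" "betti I i j \<noteq> 0"
  shows "betti (leading_ideal lt I) i j \<noteq> 0"
proof -
  interpret mono_preorder lt by unfold_locales (rule assms(1))
  have "ideal.subspace I" "ideal.subspace (leading_ideal lt I)"
    using assms(2) by (auto simp: homogeneous_ideal_def leading_ideal_def)
  with assms(2,3) show ?thesis
    using tensor_exact_degeneration[OF multigraded_taylor taylor_resolution]
    by (auto simp: betti_eq_0_iff)
qed

theorem corollary4p13:
  fixes lt :: "'n::finite monom \<Rightarrow> 'n monom \<Rightarrow> bool"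
    and I :: "('n, 'k::field) mpoly set"
  assumes "monomial_preorder lt"
    and "homogeneous_ideal I"
  shows "depth_quot I \<ge> depth_quot (leading_ideal lt I) \<and>
         reg_quot I \<le> reg_quot (leading_ideal lt I)"
proof
  note betti = betti_leading_ideal[OF assms]
  \<comment> \<open>Enlarging the set of nonzero Betti numbers can only raise the suprema. The
    supremum of the empty set is -\<infinity> in \<open>ereal\<close>, so the case S/I = 0 is
    covered.\<close>
  have "Sup {ereal (real i) | i. \<exists>j. betti I i j \<noteq> 0}
      \<le> Sup {ereal (real i) | i. \<exists>j. betti (leading_ideal lt I) i j \<noteq> 0}"
    by (rule Sup_subset_mono) (use betti in blast)
  then show "depth_quot I \<ge> depth_quot (leading_ideal lt I)"
    unfolding depth_quot_def by (rule ereal_minus_mono[OF order_refl])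
  show "reg_quot I \<le> reg_quot (leading_ideal lt I)"
    unfolding reg_quot_def by (rule Sup_subset_mono) (use betti in blast)
qed

end
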